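(* Consider the CreditRisk$^+$ model described in the context, and suppose there are two distinct obligors $A(1)\ne A(2)$ with exposures $\mathcal{E}_{A(1)}=\mathcal{E}_{A(2)}=0$. Let $\mathbb{P}_{\mathrm{Two}}$ be the 'two defaults scenario' loss distribution and $\mathbb{P}_{\mathrm{Prob}}$ the 'stressed probabilities of default' loss distribution, both defined in the context, and let $\mathbb{E}_{\mathrm{Two}}[X]$, $\mathbb{E}_{\mathrm{Prob}}[X]$ denote the expected values of the portfolio loss $X$ under these distributions. Then $$\mathbb{E}_{\mathrm{Two}}[X]=\mathbb{E}_{\mathrm{Prob}}[X].$$
   Context: Model. There is a finite set of obligors $A$ and an integer $N\ge 1$. (i) $\mathbf{S}=(S_0,S_1,\ldots,S_N)$ with $S_0=1$ constant and $S_1,\ldots,S_N$ independent; for $k\ge 1$, $S_k$ is Gamma-distributed with parameters $(\alpha_k,1/\alpha_k)$, $\alpha_k>0$, where Gamma$(a,b)$ has density $\frac{y^{a-1}}{b^a\Gamma(a)}e^{-y/b}$, $y>0$ (so $\mathbb{E}[S_k]=1$). (ii) Each obligor $A$ has a constant $p_A>0$ and weights $0\le w_{Ak}\le 1$, $k=0,\ldots,N$, with $\sum_{k=0}^N w_{Ak}=1$. The non-negative integer-valued variables $D_A$ are conditionally independent given $\mathbf{S}$, and the conditional distribution of $D_A$ given $\mathbf{S}$ is Poisson with intensity $p_A^S=p_A\sum_{k=0}^N w_{Ak}S_k$. (iii) For each obligor $A$, $\mathcal{E}_A$ is a non-negative integer-valued random variable with generating function $H_A(z)=\mathbb{E}[z^{\mathcal{E}_A}]$,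 $z\in\mathbb{C}$, $|z|\le 1$, and $\mathcal{E}_{A,1},\mathcal{E}_{A,2},\ldots$ are copies of $\mathcal{E}_A$. All the variables $\mathcal{E}_{A,i}$ (over all $A$ and $i$) are mutually independent and independent of $((D_A)_A,\mathbf{S})$. The portfolio loss is $X=\sum_A\sum_{i=1}^{D_A}\mathcal{E}_{A,i}$. Notation. For $k=0,\ldots,N$ put $\mu_k=\sum_A w_{Ak}p_A$ and $\mathcal{Q}_k(z)=\frac1{\mu_k}\sum_A w_{Ak}\,p_A\,H_A(z)$, and for $k=1,\ldots,N$ put $\delta_k=\mu_k/(\mu_k+\alpha_k)$. (If $\mu_k=0$, the products $\mu_k\mathcal{Q}_k$ and $\delta_k\mathcal{Q}_k$ are read as $0$.) For a vector $\alpha'=(\alpha'_1,\ldots,\alpha'_N)$ with positive entries, $\mathbb{P}_{\alpha'}[X=\cdot\,]$ denotes the probability distribution on the non-negative integers with generating function $$\sum_{m=0}^\infty \mathbb{P}_{\alpha'}[X=m]\,z^m = e^{\mu_0(\mathcal{Q}_0(z)-1)}\prod_{k=1}^N\left(\frac{1-\delta_k}{1-\delta_k\mathcal{Q}_k(z)}\right)^{\alpha'_k},$$ where only the exponents depend on $\alpha'$, while $\mu_0$, $\mathcal{Q}_0,\ldots,\mathcal{Q}_N$ and $\delta_1,\ldots,\delta_N$ are kept fixed at the values above computed from the original $\alpha=(\alpha_1,\ldots,\alpha_N)$. For $\alpha'=\alpha$ this is the distribution of $X$ in the model. $e_j$ denotes the $j$-th unit vector of $\mathbb{R}^N$. Definition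 of $\mathbb{P}_{\mathrm{Two}}$ (with $\mathcal{E}_{A(1)}=\mathcal{E}_{A(2)}=0$). For every non-negative integer $x$, $$\begin{aligned}\mathbb{P}_{\mathrm{Two}}[X=x]=\frac{1}{1+\sum_{k=1}^N\frac{w_{A(1)k}w_{A(2)k}}{\alpha_k}}\Big(& w_{A(1)0}w_{A(2)0}\,\mathbb{P}_\alpha[X=x]+\sum_{j=1}^N\bigl(w_{A(1)0}w_{A(2)j}+w_{A(1)j}w_{A(2)0}\bigr)\mathbb{P}_{\alpha+e_j}[X=x]\\ &+\sum_{j=1}^N w_{A(1)j}w_{A(2)j}\,\frac{\alpha_j+1}{\alpha_j}\,\mathbb{P}_{\alpha+2e_j}[X=x]+\sum_{i=1}^N\sum_{j=1,\,j\ne i}^N w_{A(1)i}w_{A(2)j}\,\mathbb{P}_{\alpha+e_i+e_j}[X=x]\Big).\end{aligned}$$ Definition of $\mathbb{P}_{\mathrm{Prob}}$. For each obligor $B\notin\{A(1),A(2)\}$ put $$q_B=\frac{p_B}{1+\sum_{k=1}^N\frac{w_{A(1)k}w_{A(2)k}}{\alpha_k}}\Big(1+2\sum_{k=1}^N\frac{w_{Bk}w_{A(1)k}w_{A(2)k}}{\alpha_k^2}+\sum_{k=1}^N\frac{w_{Bk}w_{A(1)k}+w_{Bk}w_{A(2)k}+w_{A(1)k}w_{A(2)k}}{\alpha_k}\Big).$$ $\mathbb{P}_{\mathrm{Prob}}$ is the distribution of $X$ in the model (i)--(iii) in which $p_B$ is replaced by $q_B$ for every obligor $B\notin\{A(1),A(2)\}$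 and all other model inputs (the weights $w_{Ak}$, the parameters $\alpha_k$, the exposure distributions) are unchanged; the quantities $\mu_k,\mathcal{Q}_k,\delta_k$ are recomputed accordingly. (The values of $p_{A(1)},p_{A(2)}$ do not matter for this distribution because the exposures of $A(1)$ and $A(2)$ are zero.) Expected values of $X$ are taken in $[0,\infty]$. *)

theory Defs
  imports "HOL-Probability.Probability"
begin

section \<open>Gamma distribution and conditional independence\<close>

text \<open>Shape \<open>a\<close>, scale \<open>b\<close>; the mean is \<open>a * b\<close>.\<close>

definition gamma_density :: "real \<Rightarrow> real \<Rightarrow> real \<Rightarrow> real" where
  "gamma_density a b y =
     (if y > 0 then y powr (a - 1) / (b powr a * Gamma a) * exp (- y / b) else 0)"

text \<open>Conditional independence, given the sub-sigma-algebra \<open>G\<close> of \<open>M\<close>, of a family indexed by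
  a \<^emph>\<open>finite\<close> set \<open>I\<close>. Sub-families are covered by taking \<open>B i = space (K i)\<close>.\<close>

definition cond_indep_vars ::
  "'m measure \<Rightarrow> 'm measure \<Rightarrow> ('i \<Rightarrow> 'b measure) \<Rightarrow> ('i \<Rightarrow> 'm \<Rightarrow> 'b) \<Rightarrow> 'i set \<Rightarrow> bool" where
  "cond_indep_vars M G K Y I \<longleftrightarrow>
     (\<forall>i\<in>I. Y i \<in> measurable M (K i)) \<and>
     (\<forall>B. (\<forall>i\<in>I. B i \<in> sets (K i)) \<longrightarrow>
        (AE \<omega> in M.
           real_cond_exp M G (\<lambda>\<omega>. \<Prod>i\<in>I. indicator (B i) (Y i \<omega>)) \<omega> =
           (\<Prod>i\<in>I. real_cond_exp M G (\<lambda>\<omega>. indicator (B i) (Y i \<omega>)) \<omega>)))"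

section \<open>The CreditRisk+ model\<close>

text \<open>The sigma-algebra generated by the random vector \<open>(S 0, \<dots>, S N)\<close>.\<close>

definition factor_algebra :: "'m measure \<Rightarrow> nat \<Rightarrow> (nat \<Rightarrow> 'm \<Rightarrow> real) \<Rightarrow> 'm measure" where
  "factor_algebra M N S =
     vimage_algebra (space M) (\<lambda>\<omega>. \<lambda>k\<in>{0..N}. S k \<omega>) (Pi\<^sub>M {0..N} (\<lambda>_. borel))"

text \<open>\<open>Obl\<close> is the set of obligors and \<open>F A\<close> the law of the exposure of obligor \<open>A\<close>; \<open>E A i\<close>,
  \<open>i \<ge> 1\<close>, are the copies of that exposure. The intensity in \<open>D_poisson\<close> is almost surely positive,
  so that the (arbitrary) value of \<^const>\<open>poisson_pmf\<close> at negative rates is irrelevant.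
  In \<open>E_indep_DS\<close>, independence of the exposures and \<open>((D A)\<^sub>A, S)\<close> is independence of the
  generated sigma-algebras, since \<^const>\<open>prob_space.indep_var\<close> needs both variables to have the
  same type.\<close>

locale credit_risk_plus = prob_space M for M :: "'m measure" +
  fixes Obl :: "'a set"
    and N :: nat
    and \<alpha> :: "nat \<Rightarrow> real"
    and w :: "'a \<Rightarrow> nat \<Rightarrow> real"
    and p :: "'a \<Rightarrow> real"
    and F :: "'a \<Rightarrow> nat pmf"
    and S :: "nat \<Rightarrow> 'm \<Rightarrow> real"
    and D :: "'a \<Rightarrow> 'm \<Rightarrow> nat"
    and E :: "'a \<Rightarrow> nat \<Rightarrow> 'm \<Rightarrow> nat"
  assumes finite_Obl: "finite Obl"
    and N_ge_1: "1 \<le> N"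
    and \<alpha>_pos: "\<And>k. k \<in> {1..N} \<Longrightarrow> 0 < \<alpha> k"
    and p_pos: "\<And>A. A \<in> Obl \<Longrightarrow> 0 < p A"
    and w_range: "\<And>A k. A \<in> Obl \<Longrightarrow> k \<in> {0..N} \<Longrightarrow> 0 \<le> w A k \<and> w A k \<le> 1"
    and w_sum: "\<And>A. A \<in> Obl \<Longrightarrow> (\<Sum>k=0..N. w A k) = 1"
    and S_0: "\<And>\<omega>. \<omega> \<in> space M \<Longrightarrow> S 0 \<omega> = 1"
    and S_indep: "indep_vars (\<lambda>_. borel) S {1..N}"
    and S_gamma: "\<And>k. k \<in> {1..N} \<Longrightarrow>
          distributed M lborel (S k) (\<lambda>y. ennreal (gamma_density (\<alpha> k) (1 / \<alpha> k) y))"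
    and D_cond_indep:
          "cond_indep_vars M (factor_algebra M N S) (\<lambda>_. count_space UNIV) D Obl"
    and D_poisson: "\<And>A n. A \<in> Obl \<Longrightarrow>
          AE \<omega> in M. real_cond_exp M (factor_algebra M N S) (\<lambda>\<omega>. indicator {n} (D A \<omega>)) \<omega> =
            pmf (poisson_pmf (p A * (\<Sum>k=0..N. w A k * S k \<omega>))) n"
    and E_indep: "indep_vars (\<lambda>_. count_space UNIV) (\<lambda>(A, i). E A i) (Obl \<times> {1..})"
    and E_distr: "\<And>A i. A \<in> Obl \<Longrightarrow> 1 \<le> i \<Longrightarrow>
          distr M (count_space UNIV) (E A i) = measure_pmf (F A)"
    and E_indep_DS:
          "indep_set
             (sets (vimage_algebra (space M)
               (\<lambda>\<omega>. restrict (\<lambda>(A, i). E A i \<omega>) (Obl \<times> {1..}))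
               (Pi\<^sub>M (Obl \<times> {1..}) (\<lambda>_. count_space UNIV))))
             (sets (vimage_algebra (space M)
               (\<lambda>\<omega>. (\<lambda>A\<in>Obl. D A \<omega>, \<lambda>k\<in>{0..N}. S k \<omega>))
               (Pi\<^sub>M Obl (\<lambda>_. count_space UNIV) \<Otimes>\<^sub>M Pi\<^sub>M {0..N} (\<lambda>_. borel))))"

definition portfolio_loss ::
  "'a set \<Rightarrow> ('a \<Rightarrow> 'm \<Rightarrow> nat) \<Rightarrow> ('a \<Rightarrow> nat \<Rightarrow> 'm \<Rightarrow> nat) \<Rightarrow> 'm \<Rightarrow> nat" where
  "portfolio_loss Obl D E \<omega> = (\<Sum>A\<in>Obl. \<Sum>i=1..D A \<omega>. E A i \<omega>)"

definition loss_law ::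
  "'m measure \<Rightarrow> 'a set \<Rightarrow> ('a \<Rightarrow> 'm \<Rightarrow> nat) \<Rightarrow> ('a \<Rightarrow> nat \<Rightarrow> 'm \<Rightarrow> nat) \<Rightarrow> nat measure" where
  "loss_law M Obl D E = distr M (count_space UNIV) (portfolio_loss Obl D E)"

definition mean_loss :: "nat measure \<Rightarrow> ennreal" where
  "mean_loss P = (\<integral>\<^sup>+ x. of_nat x \<partial>P)"

section \<open>The distributions with shifted exponents\<close>

definition exposure_gf :: "nat pmf \<Rightarrow> complex \<Rightarrow> complex" where
  "exposure_gf P z = measure_pmf.expectation P (\<lambda>n. z ^ n)"

definition cr_mu :: "'a set \<Rightarrow> ('a \<Rightarrow> nat \<Rightarrow> real) \<Rightarrow> ('a \<Rightarrow> real) \<Rightarrow> nat \<Rightarrow> real" where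
  "cr_mu Obl w p k = (\<Sum>A\<in>Obl. w A k * p A)"

text \<open>If \<open>cr_mu Obl w p k = 0\<close>, then \<open>cr_Q\<close> is \<open>0\<close> because \<open>1 / 0 = 0\<close>, which is consistent with
  reading the products of \<open>\<mu>\<^sub>k\<close> and of \<open>\<delta>\<^sub>k\<close> with \<open>Q\<^sub>k\<close> as \<open>0\<close>.\<close>

definition cr_Q ::
  "'a set \<Rightarrow> ('a \<Rightarrow> nat \<Rightarrow> real) \<Rightarrow> ('a \<Rightarrow> real) \<Rightarrow> ('a \<Rightarrow> nat pmf) \<Rightarrow> nat \<Rightarrow> complex \<Rightarrow> complex" where
  "cr_Q Obl w p F k z =
     1 / of_real (cr_mu Obl w p k) * (\<Sum>A\<in>Obl. of_real (w A k * p A) * exposure_gf (F A) z)"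

definition cr_delta ::
  "'a set \<Rightarrow> (nat \<Rightarrow> real) \<Rightarrow> ('a \<Rightarrow> nat \<Rightarrow> real) \<Rightarrow> ('a \<Rightarrow> real) \<Rightarrow> nat \<Rightarrow> real" where
  "cr_delta Obl \<alpha> w p k = cr_mu Obl w p k / (cr_mu Obl w p k + \<alpha> k)"

text \<open>The complex power uses the principal branch; its base lies in the right half-plane for
  \<open>norm z \<le> 1\<close>.\<close>

definition cr_gf ::
  "'a set \<Rightarrow> nat \<Rightarrow> (nat \<Rightarrow> real) \<Rightarrow> ('a \<Rightarrow> nat \<Rightarrow> real) \<Rightarrow> ('a \<Rightarrow> real) \<Rightarrow> ('a \<Rightarrow> nat pmf) \<Rightarrow>
   (nat \<Rightarrow> real) \<Rightarrow> complex \<Rightarrow> complex" where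
  "cr_gf Obl N \<alpha> w p F \<alpha>' z =
     exp (of_real (cr_mu Obl w p 0) * (cr_Q Obl w p F 0 z - 1)) *
     (\<Prod>k=1..N.
        (of_real (1 - cr_delta Obl \<alpha> w p k) /
         (1 - of_real (cr_delta Obl \<alpha> w p k) * cr_Q Obl w p F k z)) powr of_real (\<alpha>' k))"

text \<open>Only the exponents \<open>\<alpha>'\<close> vary; \<open>\<mu>\<close>, \<open>Q\<close> and \<open>\<delta>\<close> are computed from the original \<open>\<alpha>\<close>.\<close>

definition cr_law ::
  "'a set \<Rightarrow> nat \<Rightarrow> (nat \<Rightarrow> real) \<Rightarrow> ('a \<Rightarrow> nat \<Rightarrow> real) \<Rightarrow> ('a \<Rightarrow> real) \<Rightarrow> ('a \<Rightarrow> nat pmf) \<Rightarrow>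
   (nat \<Rightarrow> real) \<Rightarrow> nat pmf" where
  "cr_law Obl N \<alpha> w p F \<alpha>' =
     (THE P. \<forall>z::complex. norm z \<le> 1 \<longrightarrow>
        (\<lambda>m. of_real (pmf P m) * z ^ m) sums cr_gf Obl N \<alpha> w p F \<alpha>' z)"

section \<open>The two stress scenarios\<close>

text \<open>The joint default factor \<open>1 + \<Sum>k. w\<^sub>A\<^sub>k w\<^sub>B\<^sub>k / \<alpha>\<^sub>k\<close> of two obligors.\<close>

definition joint_factor ::
  "nat \<Rightarrow> (nat \<Rightarrow> real) \<Rightarrow> ('a \<Rightarrow> nat \<Rightarrow> real) \<Rightarrow> 'a \<Rightarrow> 'a \<Rightarrow> real" where
  "joint_factor N \<alpha> w A B = 1 + (\<Sum>k=1..N. w A k * w B k / \<alpha> k)"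

definition unit_vec :: "nat \<Rightarrow> nat \<Rightarrow> real" where
  "unit_vec j k = (if k = j then 1 else 0)"

definition two_defaults_prob ::
  "'a set \<Rightarrow> nat \<Rightarrow> (nat \<Rightarrow> real) \<Rightarrow> ('a \<Rightarrow> nat \<Rightarrow> real) \<Rightarrow> ('a \<Rightarrow> real) \<Rightarrow> ('a \<Rightarrow> nat pmf) \<Rightarrow>
   'a \<Rightarrow> 'a \<Rightarrow> nat \<Rightarrow> real" where
  "two_defaults_prob Obl N \<alpha> w p F A1 A2 x =
     (let P = (\<lambda>\<alpha>'. pmf (cr_law Obl N \<alpha> w p F \<alpha>') x) in
      1 / joint_factor N \<alpha> w A1 A2 *
      (w A1 0 * w A2 0 * P \<alpha>
       + (\<Sum>j=1..N. (w A1 0 * w A2 j + w A1 j * w A2 0) * P (\<lambda>k. \<alpha> k + unit_vec j k))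
       + (\<Sum>j=1..N. w A1 j * w A2 j * ((\<alpha> j + 1) / \<alpha> j) * P (\<lambda>k. \<alpha> k + 2 * unit_vec j k))
       + (\<Sum>i=1..N. \<Sum>j\<in>{1..N} - {i}.
            w A1 i * w A2 j * P (\<lambda>k. \<alpha> k + unit_vec i k + unit_vec j k))))"

definition two_defaults_law ::
  "'a set \<Rightarrow> nat \<Rightarrow> (nat \<Rightarrow> real) \<Rightarrow> ('a \<Rightarrow> nat \<Rightarrow> real) \<Rightarrow> ('a \<Rightarrow> real) \<Rightarrow> ('a \<Rightarrow> nat pmf) \<Rightarrow>
   'a \<Rightarrow> 'a \<Rightarrow> nat measure" where
  "two_defaults_law Obl N \<alpha> w p F A1 A2 =
     density (count_space UNIV) (\<lambda>x. ennreal (two_defaults_prob Obl N \<alpha> w p F A1 A2 x))"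

definition stressed_pd ::
  "nat \<Rightarrow> (nat \<Rightarrow> real) \<Rightarrow> ('a \<Rightarrow> nat \<Rightarrow> real) \<Rightarrow> ('a \<Rightarrow> real) \<Rightarrow> 'a \<Rightarrow> 'a \<Rightarrow> 'a \<Rightarrow> real" where
  "stressed_pd N \<alpha> w p A1 A2 B =
     (if B = A1 \<or> B = A2 then p B
      else p B / joint_factor N \<alpha> w A1 A2 *
        (1 + 2 * (\<Sum>k=1..N. w B k * w A1 k * w A2 k / (\<alpha> k)\<^sup>2)
         + (\<Sum>k=1..N. (w B k * w A1 k + w B k * w A2 k + w A1 k * w A2 k) / \<alpha> k)))"

end

theory Submission
  imports Defs
begin

text \<open>
  Both expectations are linear combinations, with finite nonnegative coefficients, of the exposure
  means \<open>e\<^sub>A\<close>, which may be infinite; those of \<open>A(1)\<close> and \<open>A(2)\<close> vanish.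

  The distribution with exponents \<open>\<alpha>'\<close> is realised as the convolution of a compound Poisson and of
  compound negative binomial distributions, so that its mean is
  \<open>\<Sum>\<^sub>A p\<^sub>A (w\<^sub>A\<^sub>0 + \<Sum>\<^sub>k w\<^sub>A\<^sub>k \<alpha>'\<^sub>k / \<alpha>\<^sub>k) e\<^sub>A\<close>. With \<open>1 / \<alpha>\<^sub>0\<close> read as \<open>0\<close>, the two defaults law is
  the mixture, over all pairs \<open>(i, j)\<close> of factors, of the laws with exponents \<open>\<alpha> + e\<^sub>i + e\<^sub>j\<close>; as
  the weights of each obligor sum to \<open>1\<close>, averaging the means gives exactly \<open>\<Sum>\<^sub>A q\<^sub>A e\<^sub>A\<close>.

  On the other side, Wald's identity gives \<open>\<Sum>\<^sub>A q\<^sub>A e\<^sub>A\<close> as well, since \<open>D\<^sub>A\<close> has mean \<open>q\<^sub>A\<close>.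
\<close>

section \<open>Generating functions of distributions on the naturals\<close>

text \<open>Real and imaginary parts reduce this to the real tower property. The bound
  \<open>B\<close> makes every integral finite, including the outer one, since the inner expectation
  is again bounded by \<open>B\<close>.\<close>

lemma expectation_bind_pmf_complex:
  fixes f :: "'b \<Rightarrow> complex"
  assumes bounded: "\<And>x. norm (f x) \<le> B"
  shows "measure_pmf.expectation (bind_pmf K L) f =
    measure_pmf.expectation K (\<lambda>x. measure_pmf.expectation (L x) f)"
proof -
  have real: "measure_pmf.expectation (bind_pmf K L) g =
      measure_pmf.expectation K (\<lambda>x. measure_pmf.expectation (L x) g)"
    if "\<And>x. \<bar>g x\<bar> \<le> B" for g :: "'b \<Rightarrow> real"
    unfolding measure_pmf_bind using that measurable_measure_pmf[of L]
    by (intro integral_bind[where B' = 1 and K = "count_space UNIV" and B = B])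
      (auto simp: measure_pmf.finite_measure_axioms)
  have int: "integrable (measure_pmf P) f" for P :: "'b pmf"
    using bounded by (intro measure_pmf.integrable_const_bound[where B = B]) auto
  have "norm (measure_pmf.expectation P f) \<le> B" for P :: "'b pmf"
    using int[of P] bounded
    by (intro order_trans[OF integral_norm_bound] measure_pmf.integral_le_const) auto
  then have int': "integrable (measure_pmf K) (\<lambda>x. measure_pmf.expectation (L x) f)"
    by (intro measure_pmf.integrable_const_bound[where B = B]) auto
  show ?thesis
  proof (rule complex_eqI)
    show "Re (measure_pmf.expectation (bind_pmf K L) f) =
        Re (measure_pmf.expectation K (\<lambda>x. measure_pmf.expectation (L x) f))"
      using real[of "\<lambda>x. Re (f x)"] order_trans[OF abs_Re_le_cmod bounded] int int'
      by (simp add: integral_Re[symmetric] del: integral_Re)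
    show "Im (measure_pmf.expectation (bind_pmf K L) f) =
        Im (measure_pmf.expectation K (\<lambda>x. measure_pmf.expectation (L x) f))"
      using real[of "\<lambda>x. Im (f x)"] order_trans[OF abs_Im_le_cmod bounded] int int'
      by (simp add: integral_Im[symmetric] del: integral_Im)
  qed
qed

lemma norm_power_le_1:
  fixes z :: complex
  shows "norm z \<le> 1 \<Longrightarrow> norm (z ^ n) \<le> 1"
  by (simp add: norm_power power_le_one)

lemma exposure_gf_bind:
  assumes "norm z \<le> 1"
  shows "exposure_gf (bind_pmf K L) z = measure_pmf.expectation K (\<lambda>x. exposure_gf (L x) z)"
  unfolding exposure_gf_def using norm_power_le_1[OF assms] by (rule expectation_bind_pmf_complex)

lemma exposure_gf_return: "exposure_gf (return_pmf n) z = z ^ n"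
  by (simp add: exposure_gf_def)

lemma norm_exposure_gf:
  assumes "norm z \<le> 1"
  shows "norm (exposure_gf P z) \<le> 1"
proof -
  have int: "integrable (measure_pmf P) (\<lambda>n. z ^ n)"
    using norm_power_le_1[OF assms] by (intro measure_pmf.integrable_const_bound[where B = 1]) auto
  show ?thesis
    unfolding exposure_gf_def using norm_power_le_1[OF assms] int
    by (intro order_trans[OF integral_norm_bound] measure_pmf.integral_le_const) auto
qed

text \<open>Passes from the expectation to the power series by which \<open>cr_law\<close>
  characterises a law. The coefficients \<open>pmf P\<close> dominate the terms on the closed unit
  disc.\<close>

lemma exposure_gf_sums:
  assumes "norm z \<le> 1"
  shows "(\<lambda>n. of_real (pmf P n) * z ^ n) sums exposure_gf P z"
proof -
  have *: "(\<lambda>n. pmf P n *\<^sub>R z ^ n) sums (\<integral>n. pmf P n *\<^sub>R z ^ n \<partial>count_space UNIV)"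
  proof (rule sums_integral_count_space_nat)
    show "integrable (count_space UNIV) (\<lambda>n. pmf P n *\<^sub>R z ^ n)"
    proof (rule Bochner_Integration.integrable_bound)
      show "integrable (count_space UNIV) (pmf P)"
        by (rule integrable_pmf)
      show "AE n in count_space UNIV. norm (pmf P n *\<^sub>R z ^ n) \<le> norm (pmf P n)"
        using norm_power_le_1[OF assms] by (auto simp: mult_left_le)
    qed simp
  qed
  also have "(\<integral>n. pmf P n *\<^sub>R z ^ n \<partial>count_space UNIV) = exposure_gf P z"
    unfolding exposure_gf_def measure_pmf_eq_density by (subst integral_density) auto
  finally show ?thesis
    by (simp add: scaleR_conv_of_real)
qed

text \<open>Two power series that agree near 0 have the same coefficients. This is the uniqueness
  half of the definite description in \<open>cr_law\<close>.\<close>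

lemma pmf_eq_if_gf_eq:
  assumes "\<And>z::complex. norm z \<le> 1 \<Longrightarrow> exposure_gf P z = exposure_gf Q z"
  shows "P = Q"
proof -
  define f where "f R = Abs_fps (\<lambda>n. complex_of_real (pmf R n))" for R
  have radius: "fps_conv_radius (f R) > 0" for R
  proof -
    have "conv_radius (fps_nth (f R)) \<ge> norm (1::complex)"
      using sums_summable[OF exposure_gf_sums[of 1 R]] by (intro conv_radius_geI) (simp add: f_def)
    then show ?thesis
      unfolding fps_conv_radius_def by (rule less_le_trans[rotated]) simp
  qed
  have eval: "eval_fps (f R) z = exposure_gf R z" if "norm z \<le> 1" for R z
    using sums_unique[OF exposure_gf_sums[OF that]] by (simp add: eval_fps_def f_def)
  have "eventually (\<lambda>z::complex. z \<in> ball 0 1) (nhds 0)"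
    by (intro eventually_nhds_in_open) auto
  then have "eventually (\<lambda>z. eval_fps (f P) z = eval_fps (f Q) z) (nhds 0)"
    by eventually_elim (simp add: eval assms)
  then have "f P = f Q"
    by (intro eval_fps_eqD radius)
  then show ?thesis
    by (intro pmf_eqI) (metis f_def fps_nth_Abs_fps of_real_eq_iff)
qed

lemma pmf_of_sums_ex:
  fixes f :: "nat \<Rightarrow> real"
  assumes "\<And>n. 0 \<le> f n" and "f sums 1"
  shows "\<exists>K. \<forall>n. pmf K n = f n"
proof -
  have "(\<integral>\<^sup>+n. ennreal (f n) \<partial>count_space UNIV) = 1"
    unfolding nn_integral_count_space_nat suminf_ennreal_eq[OF assms] by (rule ennreal_1)
  then have "pmf (embed_pmf f) n = f n" for n
    by (rule pmf_embed_pmf[OF assms(1)])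
  then show ?thesis
    by (intro exI allI)
qed

lemma mean_loss_sums:
  assumes "(\<lambda>n. real n * pmf K n) sums m"
  shows "mean_loss (measure_pmf K) = ennreal m"
proof -
  have "mean_loss (measure_pmf K) = (\<Sum>n. ennreal (real n * pmf K n))"
    unfolding mean_loss_def nn_integral_measure_pmf nn_integral_count_space_nat
    by (rule suminf_cong)
      (simp only: ennreal_of_nat_eq_real_of_nat ennreal_mult' pmf_nonneg of_nat_0_le_iff mult.commute)
  also have "\<dots> = ennreal m"
    by (rule suminf_ennreal_eq[OF _ assms]) simp
  finally show ?thesis .
qed

section \<open>Convolutions and compound distributions\<close>

definition conv_pmf :: "nat pmf \<Rightarrow> nat pmf \<Rightarrow> nat pmf" where
  "conv_pmf P Q = bind_pmf P (\<lambda>x. bind_pmf Q (\<lambda>y. return_pmf (x + y)))"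

lemma exposure_gf_conv:
  assumes "norm z \<le> 1"
  shows "exposure_gf (conv_pmf P Q) z = exposure_gf P z * exposure_gf Q z"
  by (simp add: conv_pmf_def exposure_gf_bind assms exposure_gf_return power_add)
    (simp add: exposure_gf_def)

lemma mean_loss_conv:
  "mean_loss (measure_pmf (conv_pmf P Q)) = mean_loss (measure_pmf P) + mean_loss (measure_pmf Q)"
  by (simp add: conv_pmf_def mean_loss_def nn_integral_add)

primrec iid_sum_pmf :: "nat pmf \<Rightarrow> nat \<Rightarrow> nat pmf" where
  "iid_sum_pmf Q 0 = return_pmf 0"
| "iid_sum_pmf Q (Suc n) = conv_pmf Q (iid_sum_pmf Q n)"

lemma exposure_gf_iid_sum: "norm z \<le> 1 \<Longrightarrow> exposure_gf (iid_sum_pmf Q n) z = exposure_gf Q z ^ n"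
  by (induction n) (simp_all add: exposure_gf_return exposure_gf_conv)

lemma mean_loss_iid_sum:
  "mean_loss (measure_pmf (iid_sum_pmf Q n)) = of_nat n * mean_loss (measure_pmf Q)"
  by (induction n) (simp_all add: mean_loss_conv ring_distribs, simp add: mean_loss_def)

text \<open>\<open>bind_pmf K (iid_sum_pmf Q)\<close> is the law of a sum of independent
  \<open>Q\<close>-distributed terms whose number has law \<open>K\<close>. Given \<open>n\<close>
  terms the generating function is an \<open>n\<close>-th power, so averaging over \<open>K\<close>
  composes the two functions.\<close>

lemma exposure_gf_compound:
  assumes "norm z \<le> 1"
  shows "exposure_gf (bind_pmf K (iid_sum_pmf Q)) z = exposure_gf K (exposure_gf Q z)"
  by (simp add: exposure_gf_bind exposure_gf_iid_sum assms) (simp add: exposure_gf_def)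

lemma mean_loss_compound:
  "mean_loss (measure_pmf (bind_pmf K (iid_sum_pmf Q))) =
    mean_loss (measure_pmf K) * mean_loss (measure_pmf Q)"
proof -
  have "mean_loss (measure_pmf (bind_pmf K (iid_sum_pmf Q))) =
      (\<integral>\<^sup>+n. mean_loss (measure_pmf (iid_sum_pmf Q n)) \<partial>K)"
    by (simp add: mean_loss_def)
  also have "\<dots> = mean_loss (measure_pmf K) * mean_loss (measure_pmf Q)"
    by (simp add: mean_loss_iid_sum nn_integral_multc) (simp add: mean_loss_def)
  finally show ?thesis .
qed

section \<open>Poisson, negative binomial and mixture distributions\<close>

lemma exposure_gf_poisson:
  assumes "0 < r" and "norm z \<le> 1"
  shows "exposure_gf (poisson_pmf r) z = exp (of_real r * (z - 1))"
proof -
  have "(\<lambda>n. of_real (exp (-r)) * ((of_real r * z) ^ n /\<^sub>R fact n)) sums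
      (of_real (exp (-r)) * exp (of_real r * z))"
    by (intro sums_mult exp_converges)
  moreover have "of_real (exp (-r)) * ((of_real r * z) ^ n /\<^sub>R fact n) =
      of_real (pmf (poisson_pmf r) n) * z ^ n" for n
    using assms by (simp add: scaleR_conv_of_real power_mult_distrib field_simps)
  ultimately have "exposure_gf (poisson_pmf r) z = of_real (exp (-r)) * exp (of_real r * z)"
    using sums_unique2[OF exposure_gf_sums[OF assms(2)]] by simp
  also have "\<dots> = exp (of_real r * (z - 1))"
    by (simp add: exp_of_real[symmetric] exp_add[symmetric] algebra_simps del: exp_of_real)
  finally show ?thesis .
qed

text \<open>Cancelling \<open>n\<close> against \<open>fact n\<close> and shifting the index leaves
  a multiple of the exponential series. The term at index 0 vanishes, so the shift loses
  nothing.\<close>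

lemma poisson_mean_sums:
  assumes "0 < r"
  shows "(\<lambda>n. real n * pmf (poisson_pmf r) n) sums r"
proof -
  have "(\<lambda>n. exp (-r) * r * (r ^ n /\<^sub>R fact n)) sums (exp (-r) * r * exp r)"
    by (intro sums_mult exp_converges)
  moreover have "exp (-r) * r * (r ^ n /\<^sub>R fact n) =
      real (Suc n) * pmf (poisson_pmf r) (Suc n)" for n
    using assms by (simp add: divide_simps del: of_nat_Suc)
  moreover have "exp (-r) * r * exp r = r"
    by (simp add: exp_minus)
  ultimately have "(\<lambda>n. real (Suc n) * pmf (poisson_pmf r) (Suc n)) sums r"
    by simp
  then show ?thesis
    by (subst (asm) sums_Suc_iff) simp
qed

lemma mean_loss_poisson: "0 < r \<Longrightarrow> mean_loss (measure_pmf (poisson_pmf r)) = ennreal r"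
  by (intro mean_loss_sums poisson_mean_sums)

text \<open>Binomial series with exponent \<open>- a\<close>: the sign in
  \<open>(- a) gchoose n\<close> cancels that of \<open>(- x) ^ n\<close>.\<close>

lemma pochhammer_sums_real:
  fixes a x :: real
  assumes "\<bar>x\<bar> < 1"
  shows "(\<lambda>n. pochhammer a n / fact n * x ^ n) sums ((1 - x) powr (- a))"
proof -
  have "(\<lambda>n. ((- a) gchoose n) * (- x) ^ n) sums (1 + (- x)) powr (- a)"
    by (rule gen_binomial_real) (use assms in simp)
  moreover have "((- a) gchoose n) * (- x) ^ n = pochhammer a n / fact n * x ^ n" for n
    by (cases "even n") (simp_all add: gbinomial_pochhammer)
  ultimately show ?thesis
    by simp
qed

lemma pochhammer_sums_complex:
  fixes a x :: complex
  assumes "norm x < 1"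
  shows "(\<lambda>n. pochhammer a n / fact n * x ^ n) sums ((1 - x) powr (- a))"
proof -
  have "(\<lambda>n. ((- a) gchoose n) * (- x) ^ n) sums (1 + (- x)) powr (- a)"
    by (rule gen_binomial_complex) (use assms in simp)
  moreover have "((- a) gchoose n) * (- x) ^ n = pochhammer a n / fact n * x ^ n" for n
    by (cases "even n") (simp_all add: gbinomial_pochhammer)
  ultimately show ?thesis
    by simp
qed

text \<open>Negative binomial distribution with real shape \<open>a\<close>, whose mass at
  \<open>n\<close> is \<open>(1 - d) powr a * (pochhammer a n / fact n * d ^ n)\<close>. The series
  for exponent \<open>- a\<close> gives total mass 1 and the generating function, the one for
  \<open>- (a + 1)\<close> the mean.\<close>

lemma neg_binomial_real_ex:
  fixes a d :: real
  assumes a: "0 < a" and d: "0 \<le> d" "d < 1"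
  shows "\<exists>K. (\<forall>z. norm z \<le> 1 \<longrightarrow>
      exposure_gf K z = (of_real (1 - d) / (1 - of_real d * z)) powr of_real a) \<and>
    mean_loss (measure_pmf K) = ennreal (a * (d / (1 - d)))"
proof -
  define f where "f n = (1 - d) powr a * (pochhammer a n / fact n * d ^ n)" for n
  have "0 \<le> f n" for n
    using a d by (auto simp: f_def intro!: mult_nonneg_nonneg divide_nonneg_nonneg pochhammer_nonneg)
  moreover have "f sums ((1 - d) powr a * (1 - d) powr (- a))"
    unfolding f_def using d by (intro sums_mult pochhammer_sums_real) auto
  then have "f sums 1"
    using d by (simp add: powr_minus field_simps)
  ultimately obtain K where K: "\<And>n. pmf K n = f n"
    using pmf_of_sums_ex by blast
  have gf: "exposure_gf K z = (of_real (1 - d) / (1 - of_real d * z)) powr of_real a"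
    if z: "norm z \<le> 1" for z
  proof -
    let ?u = "1 - of_real d * z"
    have less: "norm (of_real d * z) < 1"
      using d z mult_left_le[of "norm z" d] by (simp add: norm_mult)
    have "(\<lambda>n. of_real ((1 - d) powr a) *
        (pochhammer (of_real a) n / fact n * (of_real d * z) ^ n)) sums
        (of_real ((1 - d) powr a) * (?u powr (- of_real a)))"
      by (intro sums_mult pochhammer_sums_complex less)
    moreover have "of_real ((1 - d) powr a) *
        (pochhammer (of_real a) n / fact n * (of_real d * z) ^ n) = of_real (pmf K n) * z ^ n" for n
      by (simp add: K f_def pochhammer_of_real power_mult_distrib)
    ultimately have 1: "exposure_gf K z = of_real ((1 - d) powr a) * (?u powr (- of_real a))"
      using sums_unique2[OF exposure_gf_sums[OF z]] by simp
    \<comment> \<open>Splitting the principal logarithm of the quotient is legitimate because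
      \<open>?u\<close> lies in the right half-plane, away from the branch cut.\<close>
    have "Re (of_real d * z) < 1"
      using less complex_Re_le_cmod le_less_trans by blast
    then have pos: "Re ?u > 0"
      by simp
    then have nn: "?u \<notin> \<real>\<^sub>\<le>\<^sub>0" and nz: "?u \<noteq> 0"
      by (auto simp only: complex_nonpos_Reals_iff zero_complex.sel)
    have "Ln (of_real (1 - d) / ?u) = of_real (ln (1 - d)) - Ln ?u"
      using Ln_times_of_real[of "1 - d" "inverse ?u", OF _ nonzero_imp_inverse_nonzero[OF nz]]
        Ln_inverse[OF nn] Ln_of_real[of "1 - d"] d
      by (simp add: divide_inverse del: of_real_diff of_real_1)
    then have "(of_real (1 - d) / ?u) powr of_real a =
        of_real ((1 - d) powr a) * (?u powr (- of_real a))"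
      using nz d by (simp add: powr_def exp_diff exp_minus divide_inverse mult.commute
          right_diff_distrib flip: exp_of_real)
    with 1 show ?thesis
      by simp
  qed
  have "(\<lambda>n. real n * pmf K n) sums (a * (d / (1 - d)))"
  proof -
    \<comment> \<open>\<open>pochhammer a (Suc n) = a * pochhammer (a + 1) n\<close> turns the mean
      series, shifted by one index, into a binomial series for \<open>a + 1\<close>.\<close>
    have "(\<lambda>n. (1 - d) powr a * a * d * (pochhammer (a + 1) n / fact n * d ^ n)) sums
        ((1 - d) powr a * a * d * (1 - d) powr (- (a + 1)))"
      using d by (intro sums_mult pochhammer_sums_real) auto
    moreover have "(1 - d) powr a * a * d * (1 - d) powr (- (a + 1)) = a * (d / (1 - d))"
    proof -
      have "(1 - d) powr (- (a + 1)) = 1 / ((1 - d) powr a * (1 - d))"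
        using d by (simp only: powr_minus_divide powr_add) simp
      then show ?thesis
        using d by simp
    qed
    moreover have "(1 - d) powr a * a * d * (pochhammer (a + 1) n / fact n * d ^ n) =
        real (Suc n) * pmf K (Suc n)" for n
      by (simp add: K f_def pochhammer_rec field_simps del: of_nat_Suc)
    ultimately have "(\<lambda>n. real (Suc n) * pmf K (Suc n)) sums (a * (d / (1 - d)))"
      by simp
    then show ?thesis
      by (subst (asm) sums_Suc_iff) simp
  qed
  then show ?thesis
    using gf mean_loss_sums by blast
qed

text \<open>Draw an index \<open>i\<close> with probability \<open>v i / sum v I\<close>, then a
  value from \<open>F i\<close>. With \<open>v A = w A k * p A\<close> this realises
  \<open>cr_Q\<close> as a generating function.\<close>

lemma mixture_pmf_ex:
  fixes v :: "'a \<Rightarrow> real" and F :: "'a \<Rightarrow> nat pmf"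
  assumes fin: "finite I" and v: "\<And>i. i \<in> I \<Longrightarrow> 0 \<le> v i" and pos: "0 < sum v I"
  shows "\<exists>Q. (\<forall>z. norm z \<le> 1 \<longrightarrow>
      exposure_gf Q z = 1 / of_real (sum v I) * (\<Sum>i\<in>I. of_real (v i) * exposure_gf (F i) z)) \<and>
    mean_loss (measure_pmf Q) =
      ennreal (1 / sum v I) * (\<Sum>i\<in>I. ennreal (v i) * mean_loss (measure_pmf (F i)))"
proof -
  define f where "f i = (if i \<in> I then v i / sum v I else 0)" for i
  have nonneg: "\<And>i. 0 \<le> f i"
    using v pos by (auto simp: f_def)
  have "(\<integral>\<^sup>+i. ennreal (f i) \<partial>count_space UNIV) = (\<Sum>i\<in>I. ennreal (f i))"
    using fin by (intro nn_integral_count_space'[where A = I]) (auto simp: f_def)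
  also have "\<dots> = ennreal (sum f I)"
    using nonneg by (intro sum_ennreal)
  also have "sum f I = 1"
    using pos by (simp add: f_def sum_divide_distrib[symmetric])
  finally have K: "pmf (embed_pmf f) i = f i" for i
    using nonneg by (intro pmf_embed_pmf) auto
  define Q where "Q = bind_pmf (embed_pmf f) F"
  have "exposure_gf Q z = 1 / of_real (sum v I) * (\<Sum>i\<in>I. of_real (v i) * exposure_gf (F i) z)"
    if "norm z \<le> 1" for z
  proof -
    have "exposure_gf Q z = (\<Sum>i\<in>I. pmf (embed_pmf f) i *\<^sub>R exposure_gf (F i) z)"
      unfolding Q_def exposure_gf_bind[OF that]
      by (rule integral_measure_pmf[OF fin]) (auto simp: set_pmf_iff K f_def split: if_splits)
    then show ?thesis
      by (simp add: K f_def scaleR_conv_of_real sum_distrib_left)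
  qed
  moreover have "mean_loss (measure_pmf Q) =
      ennreal (1 / sum v I) * (\<Sum>i\<in>I. ennreal (v i) * mean_loss (measure_pmf (F i)))"
  proof -
    have "mean_loss (measure_pmf Q) = (\<Sum>i\<in>I. mean_loss (measure_pmf (F i)) * pmf (embed_pmf f) i)"
      unfolding Q_def mean_loss_def nn_integral_bind_pmf
      by (rule nn_integral_measure_pmf_support[OF fin])
        (auto simp: set_pmf_iff K f_def split: if_splits)
    also have "\<dots> = (\<Sum>i\<in>I. ennreal (1 / sum v I) *
        (ennreal (v i) * mean_loss (measure_pmf (F i))))"
    proof (rule sum.cong)
      fix i assume i: "i \<in> I"
      then have "ennreal (pmf (embed_pmf f) i) = ennreal (1 / sum v I) * ennreal (v i)"
        using pos v by (simp add: K f_def flip: ennreal_mult')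
      then show "mean_loss (measure_pmf (F i)) * ennreal (pmf (embed_pmf f) i) =
          ennreal (1 / sum v I) * (ennreal (v i) * mean_loss (measure_pmf (F i)))"
        by (simp add: ac_simps)
    qed simp
    finally show ?thesis
      by (simp add: sum_distrib_left)
  qed
  ultimately show ?thesis
    by blast
qed

lemma convolution_pmf_ex:
  fixes P :: "'k \<Rightarrow> nat pmf"
  assumes "finite K"
  shows "\<exists>R. (\<forall>z. norm z \<le> 1 \<longrightarrow> exposure_gf R z = (\<Prod>k\<in>K. exposure_gf (P k) z)) \<and>
    mean_loss (measure_pmf R) = (\<Sum>k\<in>K. mean_loss (measure_pmf (P k)))"
  using assms
proof induction
  case empty
  show ?case
    by (rule exI[of _ "return_pmf 0"]) (simp add: exposure_gf_return mean_loss_def)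
next
  case (insert k K)
  then obtain R where "\<forall>z. norm z \<le> 1 \<longrightarrow> exposure_gf R z = (\<Prod>k\<in>K. exposure_gf (P k) z)"
    "mean_loss (measure_pmf R) = (\<Sum>k\<in>K. mean_loss (measure_pmf (P k)))"
    by blast
  with insert.hyps show ?case
    by (intro exI[of _ "conv_pmf (P k) R"]) (simp add: exposure_gf_conv mean_loss_conv)
qed

section \<open>Means of the distributions with shifted exponents\<close>

text \<open>The construction also shows that the definite description in \<open>cr_law\<close>
  denotes. Each factor of \<open>cr_gf\<close> with positive \<open>cr_mu\<close> belongs to a
  compound distribution with severity \<open>cr_Q\<close>; the count is Poisson with rate
  \<open>cr_mu Obl w p 0\<close> for index 0, and negative binomial with shape
  \<open>\<alpha>' k\<close> and parameter \<open>cr_delta Obl \<alpha> w p k\<close>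
  otherwise.\<close>

lemma cr_law_gf_mean:
  fixes Obl :: "'a set"
  assumes fin: "finite Obl"
    and \<alpha>: "\<And>k. k \<in> {1..N} \<Longrightarrow> 0 < \<alpha> k" and \<alpha>': "\<And>k. k \<in> {1..N} \<Longrightarrow> 0 < \<alpha>' k"
    and p: "\<And>A. A \<in> Obl \<Longrightarrow> 0 \<le> p A"
    and w: "\<And>A k. A \<in> Obl \<Longrightarrow> k \<in> {0..N} \<Longrightarrow> 0 \<le> w A k"
  shows "mean_loss (measure_pmf (cr_law Obl N \<alpha> w p F \<alpha>')) =
    (\<Sum>A\<in>Obl. ennreal (p A * (w A 0 + (\<Sum>k=1..N. w A k * (\<alpha>' k / \<alpha> k)))) *
      mean_loss (measure_pmf (F A)))"
proof -
  let ?e = "\<lambda>A. mean_loss (measure_pmf (F A))"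
  let ?\<mu> = "cr_mu Obl w p" and ?\<delta> = "cr_delta Obl \<alpha> w p" and ?Q = "cr_Q Obl w p F"
  \<comment> \<open>\<open>m k\<close> stands for \<open>?\<mu> k\<close> times the mean severity of
    factor \<open>k\<close>. Free of division, it makes sense for \<open>?\<mu> k = 0\<close> as
    well, and it may be infinite.\<close>
  define m where "m k = (\<Sum>A\<in>Obl. ennreal (w A k * p A) * ?e A)" for k
  have \<mu>_nonneg: "0 \<le> ?\<mu> k" if "k \<in> {0..N}" for k
    unfolding cr_mu_def using that p w by (intro sum_nonneg) auto
  have Q_ex: "\<exists>Q. (\<forall>z. norm z \<le> 1 \<longrightarrow> exposure_gf Q z = ?Q k z) \<and>
      mean_loss (measure_pmf Q) = ennreal (1 / ?\<mu> k) * m k"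
    if "k \<in> {0..N}" "0 < ?\<mu> k" for k
    unfolding cr_Q_def cr_mu_def m_def
    by (rule mixture_pmf_ex[OF fin]) (use that p w in \<open>auto simp: cr_mu_def\<close>)
  \<comment> \<open>All \<open>w A k * p A\<close> vanish here; \<open>0 * \<infinity> = 0\<close>
    gives \<open>m k = 0\<close>, and division by 0 gives \<open>?Q k z = 0\<close>. The
    corresponding factor of \<open>cr_gf\<close> is then constantly 1, realised by the point mass at
    0.\<close>
  have \<mu>_0: "m k = 0 \<and> (\<forall>z. ?Q k z = 0)" if "k \<in> {0..N}" "?\<mu> k = 0" for k
  proof -
    have zero: "w A k * p A = 0" if "A \<in> Obl" for A
      using \<open>?\<mu> k = 0\<close> \<open>k \<in> {0..N}\<close> that p w fin
      unfolding cr_mu_def by (subst (asm) sum_nonneg_eq_0_iff) auto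
    have "m k = 0"
      unfolding m_def by (intro sum.neutral ballI) (simp only: zero ennreal_0 mult_zero_left)
    moreover have "?Q k z = 0" for z
      using that by (simp add: cr_Q_def)
    ultimately show ?thesis
      by blast
  qed
  have "\<exists>P. (\<forall>z. norm z \<le> 1 \<longrightarrow> exposure_gf P z = exp (of_real (?\<mu> 0) * (?Q 0 z - 1))) \<and>
      mean_loss (measure_pmf P) = m 0"
  proof (cases "?\<mu> 0 = 0")
    case True
    then show ?thesis
      using \<mu>_0[of 0] by (intro exI[of _ "return_pmf 0"]) (simp add: exposure_gf_return mean_loss_def)
  next
    case False
    then have pos: "0 < ?\<mu> 0"
      using \<mu>_nonneg[of 0] by simp
    obtain Q where Q: "\<forall>z. norm z \<le> 1 \<longrightarrow> exposure_gf Q z = ?Q 0 z"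
      "mean_loss (measure_pmf Q) = ennreal (1 / ?\<mu> 0) * m 0"
      using Q_ex[of 0] pos by auto
    have "mean_loss (measure_pmf (bind_pmf (poisson_pmf (?\<mu> 0)) (iid_sum_pmf Q))) =
        ennreal (?\<mu> 0 * (1 / ?\<mu> 0)) * m 0"
      using pos by (subst ennreal_mult) (simp_all add: mean_loss_compound mean_loss_poisson Q(2) mult.assoc)
    moreover have "?\<mu> 0 * (1 / ?\<mu> 0) = 1"
      using pos by simp
    moreover have "exposure_gf (bind_pmf (poisson_pmf (?\<mu> 0)) (iid_sum_pmf Q)) z =
        exp (of_real (?\<mu> 0) * (?Q 0 z - 1))" if "norm z \<le> 1" for z
      unfolding exposure_gf_compound[OF that] exposure_gf_poisson[OF pos norm_exposure_gf[OF that]]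
      using Q(1) that by simp
    ultimately show ?thesis
      by (intro exI[of _ "bind_pmf (poisson_pmf (?\<mu> 0)) (iid_sum_pmf Q)"]) simp
  qed
  then obtain P0 where P0: "\<And>z. norm z \<le> 1 \<Longrightarrow>
      exposure_gf P0 z = exp (of_real (?\<mu> 0) * (?Q 0 z - 1))"
    "mean_loss (measure_pmf P0) = m 0"
    by blast
  have "\<exists>P. (\<forall>z. norm z \<le> 1 \<longrightarrow> exposure_gf P z =
        (of_real (1 - ?\<delta> k) / (1 - of_real (?\<delta> k) * ?Q k z)) powr of_real (\<alpha>' k)) \<and>
      mean_loss (measure_pmf P) = ennreal (\<alpha>' k / \<alpha> k) * m k"
    if k: "k \<in> {1..N}" for k
  proof (cases "?\<mu> k = 0")
    case True
    then show ?thesis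
      using \<mu>_0[of k] k
      by (intro exI[of _ "return_pmf 0"]) (simp add: exposure_gf_return mean_loss_def cr_delta_def)
  next
    case False
    then have pos: "0 < ?\<mu> k"
      using \<mu>_nonneg[of k] k by simp
    obtain Q where Q: "\<forall>z. norm z \<le> 1 \<longrightarrow> exposure_gf Q z = ?Q k z"
      "mean_loss (measure_pmf Q) = ennreal (1 / ?\<mu> k) * m k"
      using Q_ex[of k] k pos by auto
    \<comment> \<open>The odds are \<open>?\<mu> k / \<alpha> k\<close>, with the original shape.
      Multiplied by the new shape \<open>\<alpha>' k\<close> they give the mean count, which is how
      the ratio \<open>\<alpha>' k / \<alpha> k\<close> arises.\<close>
    have "1 - ?\<delta> k = \<alpha> k / (?\<mu> k + \<alpha> k)"
      using pos \<alpha>[OF k] by (simp add: cr_delta_def field_simps)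
    then have \<delta>: "0 \<le> ?\<delta> k" "?\<delta> k < 1" "?\<delta> k / (1 - ?\<delta> k) = ?\<mu> k / \<alpha> k"
      using pos \<alpha>[OF k] by (auto simp: cr_delta_def)
    obtain K where K: "\<forall>z. norm z \<le> 1 \<longrightarrow>
        exposure_gf K z = (of_real (1 - ?\<delta> k) / (1 - of_real (?\<delta> k) * z)) powr of_real (\<alpha>' k)"
      "mean_loss (measure_pmf K) = ennreal (\<alpha>' k * (?\<mu> k / \<alpha> k))"
      using neg_binomial_real_ex[OF \<alpha>'[OF k] \<delta>(1,2)] unfolding \<delta>(3) by blast
    have "mean_loss (measure_pmf (bind_pmf K (iid_sum_pmf Q))) =
        ennreal (\<alpha>' k * (?\<mu> k / \<alpha> k) * (1 / ?\<mu> k)) * m k"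
      using pos \<alpha>[OF k] \<alpha>'[OF k]
      by (subst ennreal_mult) (simp_all add: mean_loss_compound K(2) Q(2) mult.assoc)
    moreover have "\<alpha>' k * (?\<mu> k / \<alpha> k) * (1 / ?\<mu> k) = \<alpha>' k / \<alpha> k"
      using pos by simp
    moreover have "exposure_gf (bind_pmf K (iid_sum_pmf Q)) z =
        (of_real (1 - ?\<delta> k) / (1 - of_real (?\<delta> k) * ?Q k z)) powr of_real (\<alpha>' k)"
      if "norm z \<le> 1" for z
      using K(1)[rule_format, OF norm_exposure_gf[OF that, of Q]] Q(1) that
      by (simp only: exposure_gf_compound)
    ultimately show ?thesis
      by (intro exI[of _ "bind_pmf K (iid_sum_pmf Q)"]) simp
  qed
  then obtain P where P: "\<And>k z. k \<in> {1..N} \<Longrightarrow> norm z \<le> 1 \<Longrightarrow> exposure_gf (P k) z =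
        (of_real (1 - ?\<delta> k) / (1 - of_real (?\<delta> k) * ?Q k z)) powr of_real (\<alpha>' k)"
      "\<And>k. k \<in> {1..N} \<Longrightarrow> mean_loss (measure_pmf (P k)) = ennreal (\<alpha>' k / \<alpha> k) * m k"
    by metis
  obtain R where R: "\<forall>z. norm z \<le> 1 \<longrightarrow> exposure_gf R z = (\<Prod>k=1..N. exposure_gf (P k) z)"
    "mean_loss (measure_pmf R) = (\<Sum>k=1..N. mean_loss (measure_pmf (P k)))"
    using convolution_pmf_ex[of "{1..N}" P] by auto
  define L where "L = conv_pmf P0 R"
  have gf: "exposure_gf L z = cr_gf Obl N \<alpha> w p F \<alpha>' z" if "norm z \<le> 1" for z
    using that by (simp add: L_def exposure_gf_conv cr_gf_def P0 R P)
  have law: "cr_law Obl N \<alpha> w p F \<alpha>' = L"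
    unfolding cr_law_def
  proof (rule the_equality)
    show "\<forall>z::complex. norm z \<le> 1 \<longrightarrow>
        (\<lambda>m. of_real (pmf L m) * z ^ m) sums cr_gf Obl N \<alpha> w p F \<alpha>' z"
      using exposure_gf_sums gf by metis
  next
    fix L' assume "\<forall>z::complex. norm z \<le> 1 \<longrightarrow>
        (\<lambda>m. of_real (pmf L' m) * z ^ m) sums cr_gf Obl N \<alpha> w p F \<alpha>' z"
    then show "L' = L"
      by (intro pmf_eq_if_gf_eq) (metis exposure_gf_sums gf sums_unique2)
  qed
  have "mean_loss (measure_pmf L) = m 0 + (\<Sum>k=1..N. ennreal (\<alpha>' k / \<alpha> k) * m k)"
    by (simp add: L_def mean_loss_conv P0 R P)
  also have "\<dots> = (\<Sum>A\<in>Obl. ennreal (w A 0 * p A) * ?e A +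
      (\<Sum>k=1..N. ennreal (\<alpha>' k / \<alpha> k) * (ennreal (w A k * p A) * ?e A)))"
    unfolding m_def sum_distrib_left sum.distrib by (subst sum.swap) simp
  also have "\<dots> = (\<Sum>A\<in>Obl. ennreal (p A * (w A 0 + (\<Sum>k=1..N. w A k * (\<alpha>' k / \<alpha> k)))) * ?e A)"
  proof (rule sum.cong)
    fix A assume A: "A \<in> Obl"
    have "(\<Sum>k=1..N. ennreal (\<alpha>' k / \<alpha> k) * (ennreal (w A k * p A) * ?e A)) =
        (\<Sum>k=1..N. ennreal (w A k * p A * (\<alpha>' k / \<alpha> k)) * ?e A)"
    proof (rule sum.cong)
      fix k assume k: "k \<in> {1..N}"
      have "0 \<le> \<alpha>' k / \<alpha> k" "0 \<le> w A k * p A"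
        using \<alpha>[OF k] \<alpha>'[OF k] w[OF A, of k] p[OF A] k by auto
      then show "ennreal (\<alpha>' k / \<alpha> k) * (ennreal (w A k * p A) * ?e A) =
          ennreal (w A k * p A * (\<alpha>' k / \<alpha> k)) * ?e A"
        by (subst ennreal_mult) (simp_all only: mult.commute mult.left_commute)
    qed simp
    also have "\<dots> = ennreal (\<Sum>k=1..N. w A k * p A * (\<alpha>' k / \<alpha> k)) * ?e A"
      unfolding sum_distrib_right[symmetric] using w[OF A] p[OF A] \<alpha> \<alpha>'
      by (subst sum_ennreal) (auto intro!: mult_nonneg_nonneg divide_nonneg_nonneg simp: less_imp_le)
    also have "ennreal (w A 0 * p A) * ?e A + \<dots> =
        ennreal (w A 0 * p A + (\<Sum>k=1..N. w A k * p A * (\<alpha>' k / \<alpha> k))) * ?e A"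
      using w[OF A] p[OF A] \<alpha> \<alpha>'
      by (subst ennreal_plus)
        (auto intro!: sum_nonneg mult_nonneg_nonneg divide_nonneg_nonneg simp: less_imp_le ring_distribs)
    also have "w A 0 * p A + (\<Sum>k=1..N. w A k * p A * (\<alpha>' k / \<alpha> k)) =
        p A * (w A 0 + (\<Sum>k=1..N. w A k * (\<alpha>' k / \<alpha> k)))"
      by (simp add: ring_distribs sum_distrib_left ac_simps)
    finally show "ennreal (w A 0 * p A) * ?e A +
        (\<Sum>k=1..N. ennreal (\<alpha>' k / \<alpha> k) * (ennreal (w A k * p A) * ?e A)) =
        ennreal (p A * (w A 0 + (\<Sum>k=1..N. w A k * (\<alpha>' k / \<alpha> k)))) * ?e A" .
  qed simp
  finally show ?thesis
    by (simp only: law)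
qed

section \<open>Mean loss in the model\<close>

text \<open>The substitution \<open>y = b * t\<close> leaves \<open>b / Gamma a\<close> times the
  integral for \<open>Gamma (a + 1)\<close>, which equals \<open>a * Gamma a\<close>.\<close>

lemma nn_integral_gamma_density:
  assumes a: "0 < a" and b: "0 < b"
  shows "(\<integral>\<^sup>+y. ennreal (gamma_density a b y) * ennreal y \<partial>lborel) = ennreal (a * b)"
proof -
  have [measurable]: "gamma_density a b \<in> borel_measurable borel"
    unfolding gamma_density_def[abs_def] by measurable
  have "gamma_density a b (b * t) * (b * t) =
      1 / Gamma a * (indicator {0..} t * t powr ((a + 1) - 1) / exp t)" for t
  proof (cases "0 < t")
    case True
    have "t powr a = t powr (a - 1) * t" "b powr a = b powr (a - 1) * b"
      using True b powr_add[of t "a - 1" 1] powr_add[of b "a - 1" 1] by simp_all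
    then show ?thesis
      using True a b by (simp add: gamma_density_def powr_mult exp_minus field_simps)
  next
    case False
    then show ?thesis
      using b by (auto simp: gamma_density_def indicator_def zero_less_mult_iff)
  qed
  moreover have "0 \<le> gamma_density a b (b * t)" for t
    using a b by (auto simp: gamma_density_def)
  moreover have inv: "0 \<le> 1 / Gamma a"
    using a by simp
  ultimately have "ennreal (gamma_density a b (0 + b * t)) * ennreal (0 + b * t) =
      ennreal (1 / Gamma a) * ennreal (indicator {0..} t * t powr ((a + 1) - 1) / exp t)" for t
    by (simp only: add_0 ennreal_mult'[symmetric])
  then have "(\<integral>\<^sup>+y. ennreal (gamma_density a b y) * ennreal y \<partial>lborel) =
      ennreal b * (ennreal (1 / Gamma a) * ennreal (Gamma (a + 1)))"
    using a b by (subst nn_integral_real_affine[of _ b 0])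
      (simp_all add: nn_integral_cmult Gamma_conv_nn_integral_real)
  also have "\<dots> = ennreal (b * (1 / Gamma a * Gamma (a + 1)))"
    using b inv by (simp only: ennreal_mult' less_imp_le)
  also have "b * (1 / Gamma a * Gamma (a + 1)) = a * b"
  proof -
    have "Gamma a \<noteq> 0"
      using Gamma_real_pos[OF a] by linarith
    moreover have "Gamma (a + 1) = a * Gamma a"
      using a by (intro Gamma_plus1) (auto simp: nonpos_Ints_def)
    ultimately show ?thesis
      by simp
  qed
  finally show ?thesis .
qed

section \<open>Series of indicators and the Poisson mean\<close>

lemma suminf_indicator_singleton:
  fixes f :: "nat \<Rightarrow> ennreal"
  shows "(\<Sum>n. f n * indicator {n} m) = f m"
  by (subst suminf_finite[of "{m}"]) (auto simp: indicator_def)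

text \<open>For random \<open>d\<close>, this replaces a random summation limit by indicators over a
  fixed range, so that sum and integral can be exchanged. The shift is there because the exposures
  are numbered from 1.\<close>

lemma suminf_indicator_atLeast_Suc:
  fixes f :: "nat \<Rightarrow> ennreal"
  shows "(\<Sum>i. indicator {Suc i..} d * f (Suc i)) = (\<Sum>i=1..d. f i)"
proof -
  have "(\<Sum>i. indicator {Suc i..} d * f (Suc i)) = (\<Sum>i<d. f (Suc i))"
    by (subst suminf_finite[of "{..<d}"]) (auto simp: indicator_def)
  then show ?thesis
    by (simp add: sum.atLeast1_atMost_eq lessThan_atLeast0)
qed

lemma suminf_poisson_mean:
  assumes "0 < r"
  shows "(\<Sum>n. of_nat n * ennreal (pmf (poisson_pmf r) n)) = ennreal r"
proof -
  have "(\<Sum>n. of_nat n * ennreal (pmf (poisson_pmf r) n)) = (\<Sum>n. ennreal (real n * pmf (poisson_pmf r) n))"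
    by (rule suminf_cong) (simp only: ennreal_of_nat_eq_real_of_nat ennreal_mult' of_nat_0_le_iff)
  also have "\<dots> = ennreal r"
    by (rule suminf_ennreal_eq[OF _ poisson_mean_sums[OF assms]]) (intro mult_nonneg_nonneg pmf_nonneg of_nat_0_le_iff)
  finally show ?thesis .
qed

section \<open>Factors, default intensities and mean default counts\<close>

context credit_risk_plus
begin

lemma S_measurable: "k \<in> {0..N} \<Longrightarrow> S k \<in> borel_measurable M"
proof (cases "k = 0")
  case True
  have "S 0 \<in> borel_measurable M \<longleftrightarrow> (\<lambda>_. 1 :: real) \<in> borel_measurable M"
    by (rule measurable_cong) (simp add: S_0)
  with True show ?thesis
    by simp
next
  case False
  assume "k \<in> {0..N}"
  with False S_indep show ?thesis
    by (auto simp: indep_vars_def)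
qed

lemma D_measurable: "A \<in> Obl \<Longrightarrow> D A \<in> measurable M (count_space UNIV)"
  using D_cond_indep by (auto simp: cond_indep_vars_def)

lemma E_measurable: "A \<in> Obl \<Longrightarrow> 1 \<le> i \<Longrightarrow> E A i \<in> measurable M (count_space UNIV)"
  using E_indep by (auto simp: indep_vars_def)

lemma borel_measurable_D:
  fixes f :: "nat \<Rightarrow> ennreal"
  shows "A \<in> Obl \<Longrightarrow> (\<lambda>\<omega>. f (D A \<omega>)) \<in> borel_measurable M"
  by (rule measurable_compose[OF D_measurable]) auto

lemma borel_measurable_E:
  fixes f :: "nat \<Rightarrow> ennreal"
  shows "A \<in> Obl \<Longrightarrow> 1 \<le> i \<Longrightarrow> (\<lambda>\<omega>. f (E A i \<omega>)) \<in> borel_measurable M"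
  by (rule measurable_compose[OF E_measurable]) auto

lemma factor_subalgebra: "finite_measure_subalgebra M (factor_algebra M N S)"
proof unfold_locales
  have "(\<lambda>\<omega>. \<lambda>k\<in>{0..N}. S k \<omega>) \<in> measurable M (Pi\<^sub>M {0..N} (\<lambda>_. borel))"
    by (intro measurable_restrict S_measurable)
  then have "sets (factor_algebra M N S) \<subseteq> sets M"
    unfolding factor_algebra_def by (intro sets_image_in_sets) auto
  then show "subalgebra M (factor_algebra M N S)"
    by (simp add: subalgebra_def) (simp add: factor_algebra_def)
qed

lemma S_mean: "k \<in> {0..N} \<Longrightarrow> (\<integral>\<^sup>+\<omega>. ennreal (S k \<omega>) \<partial>M) = 1"
proof (cases "k = 0")
  case True
  have "(\<integral>\<^sup>+\<omega>. ennreal (S 0 \<omega>) \<partial>M) = (\<integral>\<^sup>+\<omega>. 1 \<partial>M)"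
    by (intro nn_integral_cong) (simp add: S_0)
  with True show ?thesis
    by (simp add: emeasure_space_1)
next
  case False
  assume "k \<in> {0..N}"
  with False have k: "k \<in> {1..N}"
    by auto
  show ?thesis
    using distributed_nn_integral[OF S_gamma[OF k], of ennreal] \<alpha>_pos[OF k]
    by (simp add: nn_integral_gamma_density)
qed

lemma S_pos: "k \<in> {0..N} \<Longrightarrow> AE \<omega> in M. 0 < S k \<omega>"
proof (cases "k = 0")
  case True
  then show ?thesis
    by (intro AE_I2) (simp add: S_0)
next
  case False
  assume "k \<in> {0..N}"
  with False have k: "k \<in> {1..N}"
    by auto
  show ?thesis
    by (subst distributed_AE2[OF S_gamma[OF k]]) (auto simp: gamma_density_def)
qed

definition intensity :: "'a \<Rightarrow> 'm \<Rightarrow> real" where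
  "intensity A \<omega> = p A * (\<Sum>k=0..N. w A k * S k \<omega>)"

text \<open>As the weights sum to 1, at least one of them is positive, and all factors are almost
  surely positive. This puts the rate in the range where \<open>poisson_pmf\<close> has the rate as
  its mean.\<close>

lemma intensity_pos:
  assumes A: "A \<in> Obl"
  shows "AE \<omega> in M. 0 < intensity A \<omega>"
proof -
  obtain k where k: "k \<in> {0..N}" "w A k \<noteq> 0"
    using w_sum[OF A] sum.neutral[of "{0..N}" "w A"] by fastforce
  have "AE \<omega> in M. \<forall>j\<in>{0..N}. 0 < S j \<omega>"
    by (rule AE_finite_allI) (auto intro: S_pos)
  then show ?thesis
  proof eventually_elim
    case (elim \<omega>)
    have "0 < (\<Sum>j=0..N. w A j * S j \<omega>)"
      using k w_range[OF A] elim
      by (intro sum_pos2[of _ k]) (auto intro!: mult_pos_pos mult_nonneg_nonneg simp: less_imp_le order.not_eq_order_implies_strict)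
    then show ?case
      using p_pos[OF A] by (simp add: intensity_def)
  qed
qed

lemma intensity_mean:
  assumes A: "A \<in> Obl"
  shows "(\<integral>\<^sup>+\<omega>. ennreal (intensity A \<omega>) \<partial>M) = ennreal (p A)"
proof -
  have nonneg: "0 \<le> p A * w A k" if "k \<in> {0..N}" for k
    using p_pos[OF A] w_range[OF A that] by simp
  have "AE \<omega> in M. \<forall>j\<in>{0..N}. 0 < S j \<omega>"
    by (rule AE_finite_allI) (auto intro: S_pos)
  \<comment> \<open>\<open>ennreal\<close> truncates negative values to 0, so the sum is split only
    where all factors are positive.\<close>
  then have "AE \<omega> in M. ennreal (intensity A \<omega>) = (\<Sum>k=0..N. ennreal (p A * w A k) * ennreal (S k \<omega>))"
  proof eventually_elim
    case (elim \<omega>)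
    have "(\<Sum>k=0..N. ennreal (p A * w A k) * ennreal (S k \<omega>)) =
        (\<Sum>k=0..N. ennreal (p A * w A k * S k \<omega>))"
      using elim nonneg by (intro sum.cong) (auto simp: ennreal_mult less_imp_le)
    also have "\<dots> = ennreal (\<Sum>k=0..N. p A * w A k * S k \<omega>)"
      using elim by (intro sum_ennreal mult_nonneg_nonneg[OF nonneg]) (auto simp: less_imp_le)
    finally show ?case
      by (simp add: intensity_def sum_distrib_left mult.assoc)
  qed
  then have "(\<integral>\<^sup>+\<omega>. ennreal (intensity A \<omega>) \<partial>M) =
      (\<integral>\<^sup>+\<omega>. (\<Sum>k=0..N. ennreal (p A * w A k) * ennreal (S k \<omega>)) \<partial>M)"
    by (rule nn_integral_cong_AE)
  also have "\<dots> = (\<Sum>k=0..N. ennreal (p A * w A k))"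
    using S_measurable by (subst nn_integral_sum) (simp_all add: nn_integral_cmult S_mean)
  also have "\<dots> = ennreal (\<Sum>k=0..N. p A * w A k)"
    using nonneg by (intro sum_ennreal)
  also have "(\<Sum>k=0..N. p A * w A k) = p A"
    using w_sum[OF A] by (simp flip: sum_distrib_left)
  finally show ?thesis .
qed

text \<open>The mean is the series of \<open>n\<close> times the probability of
  \<open>D A = n\<close>, and each probability is the integral of its conditional version
  \<open>h n\<close>. Exchanging series and integral leaves the mean of a Poisson law with random
  rate, that is the intensity, whose mean is \<open>p A\<close>.\<close>

lemma D_mean:
  assumes A: "A \<in> Obl"
  shows "(\<integral>\<^sup>+\<omega>. of_nat (D A \<omega>) \<partial>M) = ennreal (p A)"
proof -
  interpret G: finite_measure_subalgebra M "factor_algebra M N S"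
    by (rule factor_subalgebra)
  have [measurable]: "D A \<in> measurable M (count_space UNIV)"
    using A by (rule D_measurable)
  define h where "h n = real_cond_exp M (factor_algebra M N S) (\<lambda>\<omega>. indicator {n} (D A \<omega>))" for n
  have h: "AE \<omega> in M. h n \<omega> = pmf (poisson_pmf (intensity A \<omega>)) n" for n
    unfolding h_def intensity_def by (rule D_poisson[OF A])
  have [measurable]: "(\<lambda>\<omega>. indicator {n} (D A \<omega>) :: ennreal) \<in> borel_measurable M" for n
    using A by (rule borel_measurable_D)
  have [measurable]: "h n \<in> borel_measurable M" for n
    by (simp add: h_def)
  have prob: "(\<integral>\<^sup>+\<omega>. indicator {n} (D A \<omega>) \<partial>M) = (\<integral>\<^sup>+\<omega>. ennreal (h n \<omega>) \<partial>M)" for n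
  proof -
    have int: "integrable M (\<lambda>\<omega>. indicator {n} (D A \<omega>) :: real)"
      by (rule integrable_const_bound[where B = 1])
        (auto intro: measurable_compose[OF D_measurable[OF A]])
    have "(\<integral>\<^sup>+\<omega>. indicator {n} (D A \<omega>) \<partial>M) = (\<integral>\<^sup>+\<omega>. ennreal (indicator {n} (D A \<omega>)) \<partial>M)"
      by (simp only: ennreal_indicator)
    also have "\<dots> = ennreal (\<integral>\<omega>. indicator {n} (D A \<omega>) \<partial>M)"
      by (rule nn_integral_eq_integral[OF int]) simp
    also have "(\<integral>\<omega>. indicator {n} (D A \<omega>) \<partial>M) = (\<integral>\<omega>. h n \<omega> \<partial>M)"
      unfolding h_def by (rule G.real_cond_exp_int(2)[OF int, symmetric])
    also have "ennreal \<dots> = (\<integral>\<^sup>+\<omega>. ennreal (h n \<omega>) \<partial>M)"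
    proof (rule nn_integral_eq_integral[symmetric])
      show "integrable M (h n)"
        unfolding h_def by (rule G.real_cond_exp_int(1)[OF int])
      show "AE \<omega> in M. 0 \<le> h n \<omega>"
        using h[of n] by eventually_elim (simp only: pmf_nonneg)
    qed
    finally show ?thesis .
  qed
  have "(\<integral>\<^sup>+\<omega>. of_nat (D A \<omega>) \<partial>M) = (\<integral>\<^sup>+\<omega>. (\<Sum>n. of_nat n * indicator {n} (D A \<omega>)) \<partial>M)"
    by (simp only: suminf_indicator_singleton)
  also have "\<dots> = (\<Sum>n. of_nat n * (\<integral>\<^sup>+\<omega>. indicator {n} (D A \<omega>) \<partial>M))"
    by (subst nn_integral_suminf) (auto simp: nn_integral_cmult intro!: suminf_cong nn_integral_cmult)
  also have "\<dots> = (\<Sum>n. of_nat n * (\<integral>\<^sup>+\<omega>. ennreal (h n \<omega>) \<partial>M))"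
    by (simp only: prob)
  also have "\<dots> = (\<integral>\<^sup>+\<omega>. (\<Sum>n. of_nat n * ennreal (h n \<omega>)) \<partial>M)"
    by (subst nn_integral_suminf) (auto intro!: suminf_cong nn_integral_cmult[symmetric])
  also have "\<dots> = (\<integral>\<^sup>+\<omega>. ennreal (intensity A \<omega>) \<partial>M)"
  proof (rule nn_integral_cong_AE)
    \<comment> \<open>Countably many null sets, one for each \<open>n\<close>, are merged before the
      series is evaluated pointwise.\<close>
    have "AE \<omega> in M. \<forall>n. h n \<omega> = pmf (poisson_pmf (intensity A \<omega>)) n"
      using h by (simp only: AE_all_countable) simp
    with intensity_pos[OF A]
    show "AE \<omega> in M. (\<Sum>n. of_nat n * ennreal (h n \<omega>)) = ennreal (intensity A \<omega>)"
      by eventually_elim (simp only: suminf_poisson_mean)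
  qed
  finally show ?thesis
    by (simp only: intensity_mean[OF A])
qed

section \<open>Wald's identity for the portfolio loss\<close>

lemma E_mean:
  assumes "A \<in> Obl" "1 \<le> i"
  shows "(\<integral>\<^sup>+\<omega>. of_nat (E A i \<omega>) \<partial>M) = mean_loss (measure_pmf (F A))"
  unfolding mean_loss_def E_distr[OF assms, symmetric]
  using E_measurable[OF assms] by (subst nn_integral_distr) auto

text \<open>Both events are preimages of cylinder sets under the random vectors in
  \<open>E_indep_DS\<close>, hence lie in the two independent sigma-algebras.\<close>

lemma indep_D_E:
  assumes A: "A \<in> Obl" and i: "1 \<le> i"
  shows "emeasure M ({\<omega>\<in>space M. E A i \<omega> = n} \<inter> {\<omega>\<in>space M. m \<le> D A \<omega>}) =
    emeasure M {\<omega>\<in>space M. E A i \<omega> = n} * emeasure M {\<omega>\<in>space M. m \<le> D A \<omega>}"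
proof -
  let ?PE = "Pi\<^sub>M (Obl \<times> {1..}) (\<lambda>_. count_space (UNIV :: nat set))"
  let ?PD = "Pi\<^sub>M Obl (\<lambda>_. count_space (UNIV :: nat set)) \<Otimes>\<^sub>M Pi\<^sub>M {0..N} (\<lambda>_. borel :: real measure)"
  let ?fE = "\<lambda>\<omega>. restrict (\<lambda>(A, i). E A i \<omega>) (Obl \<times> {1..})"
  let ?fD = "\<lambda>\<omega>. (\<lambda>A\<in>Obl. D A \<omega>, \<lambda>k\<in>{0..N}. S k \<omega>)"
  have Ai: "(A, i) \<in> Obl \<times> {1..}"
    using A i by simp
  have "{x \<in> space ?PE. x (A, i) = n} \<in> sets ?PE"
    using measurable_component_singleton[OF Ai, of "\<lambda>_. count_space UNIV"] by measurable
  from in_vimage_algebra[OF this, of ?fE "space M"]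
  have 1: "{\<omega>\<in>space M. E A i \<omega> = n} \<in> sets (vimage_algebra (space M) ?fE ?PE)"
    using A i by (elim back_subst[of "\<lambda>B. B \<in> _"]) (auto simp: space_PiM)
  have "{x \<in> space ?PD. m \<le> fst x A} \<in> sets ?PD"
    using measurable_compose[OF measurable_fst measurable_component_singleton[OF A, of "\<lambda>_. count_space UNIV"]]
    by measurable
  from in_vimage_algebra[OF this, of ?fD "space M"]
  have 2: "{\<omega>\<in>space M. m \<le> D A \<omega>} \<in> sets (vimage_algebra (space M) ?fD ?PD)"
    using A by (elim back_subst[of "\<lambda>B. B \<in> _"]) (auto simp: space_PiM space_pair_measure)
  show ?thesis
    using indep_setD[OF E_indep_DS 1 2] by (simp add: emeasure_eq_measure ennreal_mult)
qed

text \<open>One term of Wald's identity. Decomposing \<open>E A i\<close> by its values reduces the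
  product formula to the events of \<open>indep_D_E\<close>; nonnegativity lets series and integral
  be exchanged, even if the mean exposure is infinite.\<close>

lemma stopped_exposure_mean:
  assumes A: "A \<in> Obl" and i: "1 \<le> i"
  shows "(\<integral>\<^sup>+\<omega>. indicator {i..} (D A \<omega>) * of_nat (E A i \<omega>) \<partial>M) =
    (\<integral>\<^sup>+\<omega>. indicator {i..} (D A \<omega>) \<partial>M) * mean_loss (measure_pmf (F A))"
proof -
  note [measurable] = D_measurable[OF A] E_measurable[OF A i]
  have [measurable]: "(\<lambda>\<omega>. indicator {n} (E A i \<omega>) :: ennreal) \<in> borel_measurable M"
    "(\<lambda>\<omega>. indicator {i..} (D A \<omega>) :: ennreal) \<in> borel_measurable M" for n
    using borel_measurable_D[OF A] borel_measurable_E[OF A i] by blast+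
  let ?D = "{\<omega>\<in>space M. i \<le> D A \<omega>}" and ?E = "\<lambda>n. {\<omega>\<in>space M. E A i \<omega> = n}"
  have D: "(\<integral>\<^sup>+\<omega>. indicator {i..} (D A \<omega>) \<partial>M) = emeasure M ?D"
  proof -
    have "(\<integral>\<^sup>+\<omega>. indicator {i..} (D A \<omega>) \<partial>M) = (\<integral>\<^sup>+\<omega>. indicator ?D \<omega> \<partial>M)"
      by (rule nn_integral_cong) (simp add: indicator_def)
    then show ?thesis
      by (simp add: nn_integral_indicator)
  qed
  have E: "(\<integral>\<^sup>+\<omega>. indicator {n} (E A i \<omega>) \<partial>M) = emeasure M (?E n)" for n
  proof -
    have "(\<integral>\<^sup>+\<omega>. indicator {n} (E A i \<omega>) \<partial>M) = (\<integral>\<^sup>+\<omega>. indicator (?E n) \<omega> \<partial>M)"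
      by (rule nn_integral_cong) (simp add: indicator_def)
    then show ?thesis
      by (simp add: nn_integral_indicator)
  qed
  have DE: "(\<integral>\<^sup>+\<omega>. indicator {n} (E A i \<omega>) * indicator {i..} (D A \<omega>) \<partial>M) = emeasure M (?E n \<inter> ?D)" for n
  proof -
    have "(\<integral>\<^sup>+\<omega>. indicator {n} (E A i \<omega>) * indicator {i..} (D A \<omega>) \<partial>M) =
        (\<integral>\<^sup>+\<omega>. indicator (?E n \<inter> ?D) \<omega> \<partial>M)"
      by (rule nn_integral_cong) (simp add: indicator_def)
    then show ?thesis
      by (simp add: nn_integral_indicator)
  qed
  have "(\<integral>\<^sup>+\<omega>. indicator {i..} (D A \<omega>) * of_nat (E A i \<omega>) \<partial>M) =
      (\<integral>\<^sup>+\<omega>. (\<Sum>n. of_nat n * indicator {n} (E A i \<omega>)) * indicator {i..} (D A \<omega>) \<partial>M)"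
    by (simp only: suminf_indicator_singleton mult.commute)
  also have "\<dots> = (\<integral>\<^sup>+\<omega>. (\<Sum>n. of_nat n * (indicator {n} (E A i \<omega>) * indicator {i..} (D A \<omega>))) \<partial>M)"
    by (simp only: ennreal_suminf_multc[symmetric] mult.assoc)
  also have "\<dots> = (\<Sum>n. of_nat n * (\<integral>\<^sup>+\<omega>. indicator {n} (E A i \<omega>) * indicator {i..} (D A \<omega>) \<partial>M))"
    by (subst nn_integral_suminf) (auto intro!: suminf_cong nn_integral_cmult)
  also have "\<dots> = (\<Sum>n. of_nat n * (\<integral>\<^sup>+\<omega>. indicator {n} (E A i \<omega>) \<partial>M)) * emeasure M ?D"
    by (simp only: DE E indep_D_E[OF A i] ennreal_suminf_multc[symmetric] mult.assoc)
  also have "(\<Sum>n. of_nat n * (\<integral>\<^sup>+\<omega>. indicator {n} (E A i \<omega>) \<partial>M)) =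
      (\<integral>\<^sup>+\<omega>. (\<Sum>n. of_nat n * indicator {n} (E A i \<omega>)) \<partial>M)"
    by (subst nn_integral_suminf) (auto intro!: suminf_cong nn_integral_cmult[symmetric])
  also have "\<dots> = mean_loss (measure_pmf (F A))"
    by (simp only: suminf_indicator_singleton E_mean[OF A i])
  finally show ?thesis
    by (simp only: D mult.commute)
qed

text \<open>With the loss written through indicators of \<open>Suc i \<le> D A \<omega>\<close>,
  each exposure separates from the count, and the tail sum formula turns the remaining probabilities
  into the mean of \<open>D A\<close>, which is \<open>p A\<close>.\<close>

lemma mean_loss_law:
  "mean_loss (loss_law M Obl D E) = (\<Sum>A\<in>Obl. ennreal (p A) * mean_loss (measure_pmf (F A)))"
proof -
  have rewrite: "of_nat (portfolio_loss Obl D E \<omega>) =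
      (\<Sum>A\<in>Obl. \<Sum>i. indicator {Suc i..} (D A \<omega>) * of_nat (E A (Suc i) \<omega>) :: ennreal)" for \<omega>
    unfolding portfolio_loss_def of_nat_sum
    by (intro sum.cong suminf_indicator_atLeast_Suc[symmetric] refl)
  have [measurable]: "(\<lambda>\<omega>. indicator {Suc i..} (D A \<omega>) * of_nat (E A (Suc i) \<omega>) :: ennreal) \<in> borel_measurable M"
    if "A \<in> Obl" for A i
    using that by (intro borel_measurable_times_ennreal borel_measurable_D borel_measurable_E) auto
  have meas: "(\<lambda>\<omega>. of_nat (portfolio_loss Obl D E \<omega>) :: ennreal) \<in> borel_measurable M"
    unfolding rewrite by (intro borel_measurable_sum borel_measurable_suminf_order) measurable
  \<comment> \<open>The number of summands is random, so measurability is transferred from the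
    series in \<open>ennreal\<close>, singletons being pulled back along the injective
    \<open>of_nat\<close>.\<close>
  have "portfolio_loss Obl D E \<in> measurable M (count_space UNIV)"
  proof (subst measurable_count_space_eq2_countable, safe)
    fix n
    have "portfolio_loss Obl D E -` {n} \<inter> space M =
        (\<lambda>\<omega>. of_nat (portfolio_loss Obl D E \<omega>) :: ennreal) -` {of_nat n} \<inter> space M"
      by auto
    also have "\<dots> \<in> sets M"
      by (rule measurable_sets[OF meas]) simp
    finally show "portfolio_loss Obl D E -` {n} \<inter> space M \<in> sets M" .
  qed simp_all
  then have "mean_loss (loss_law M Obl D E) = (\<integral>\<^sup>+\<omega>. of_nat (portfolio_loss Obl D E \<omega>) \<partial>M)"
    unfolding mean_loss_def loss_law_def by (subst nn_integral_distr) auto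
  also have "\<dots> = (\<Sum>A\<in>Obl. \<Sum>i. \<integral>\<^sup>+\<omega>. indicator {Suc i..} (D A \<omega>) * of_nat (E A (Suc i) \<omega>) \<partial>M)"
    unfolding rewrite by (subst nn_integral_sum) (auto simp: nn_integral_suminf)
  also have "\<dots> = (\<Sum>A\<in>Obl. (\<Sum>i. \<integral>\<^sup>+\<omega>. indicator {Suc i..} (D A \<omega>) \<partial>M) * mean_loss (measure_pmf (F A)))"
    by (intro sum.cong) (simp_all add: stopped_exposure_mean)
  also have "\<dots> = (\<Sum>A\<in>Obl. ennreal (p A) * mean_loss (measure_pmf (F A)))"
  proof (intro sum.cong arg_cong2[where f = "(*)"])
    fix A assume A: "A \<in> Obl"
    have "(\<Sum>i. \<integral>\<^sup>+\<omega>. indicator {Suc i..} (D A \<omega>) \<partial>M) =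
        (\<integral>\<^sup>+\<omega>. (\<Sum>i. indicator {Suc i..} (D A \<omega>) * 1) \<partial>M)"
      using borel_measurable_D[OF A] by (subst nn_integral_suminf) simp_all
    also have "\<dots> = (\<integral>\<^sup>+\<omega>. of_nat (D A \<omega>) \<partial>M)"
      by (simp only: suminf_indicator_atLeast_Suc[of _ "\<lambda>_. 1"]) simp
    finally show "(\<Sum>i. \<integral>\<^sup>+\<omega>. indicator {Suc i..} (D A \<omega>) \<partial>M) = ennreal (p A)"
      by (simp only: D_mean[OF A])
  qed simp_all
  finally show ?thesis .
qed

end

section \<open>Mean loss in the two defaults scenario\<close>

text \<open>\<open>cr_gf\<close> reads the exponents only at the indices \<open>1..N\<close>, so a
  shift at index 0 does not change the law.\<close>

lemma cr_law_cong:
  assumes "\<And>k. k \<in> {1..N} \<Longrightarrow> \<beta> k = \<gamma> k"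
  shows "cr_law Obl N \<alpha> w p F \<beta> = cr_law Obl N \<alpha> w p F \<gamma>"
  using assms by (simp add: cr_law_def cr_gf_def)

lemma mean_loss_mixture:
  fixes P :: "'i \<Rightarrow> nat pmf"
  assumes "finite I" and "\<And>i. i \<in> I \<Longrightarrow> 0 \<le> d i"
  shows "mean_loss (density (count_space UNIV) (\<lambda>x. ennreal (\<Sum>i\<in>I. d i * pmf (P i) x))) =
    (\<Sum>i\<in>I. ennreal (d i) * mean_loss (measure_pmf (P i)))"
proof -
  have "mean_loss (density (count_space UNIV) (\<lambda>x. ennreal (\<Sum>i\<in>I. d i * pmf (P i) x))) =
      (\<integral>\<^sup>+x. (\<Sum>i\<in>I. ennreal (d i) * (ennreal (pmf (P i) x) * of_nat x)) \<partial>count_space UNIV)"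
    unfolding mean_loss_def
  proof (subst nn_integral_density, simp, simp, intro nn_integral_cong)
    fix x :: nat
    have "ennreal (\<Sum>i\<in>I. d i * pmf (P i) x) = (\<Sum>i\<in>I. ennreal (d i) * ennreal (pmf (P i) x))"
      using assms(2) by (subst sum_ennreal[symmetric]) (auto simp: ennreal_mult intro!: sum.cong)
    then show "ennreal (\<Sum>i\<in>I. d i * pmf (P i) x) * of_nat x =
        (\<Sum>i\<in>I. ennreal (d i) * (ennreal (pmf (P i) x) * of_nat x))"
      by (simp only: sum_distrib_right mult.assoc)
  qed
  also have "\<dots> = (\<Sum>i\<in>I. ennreal (d i) * (\<integral>\<^sup>+x. ennreal (pmf (P i) x) * of_nat x \<partial>count_space UNIV))"
    by (subst nn_integral_sum) (auto intro!: sum.cong nn_integral_cmult)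
  finally show ?thesis
    by (simp only: mean_loss_def nn_integral_measure_pmf)
qed

text \<open>The four groups are those of \<open>two_defaults_prob\<close>: both indices 0, exactly
  one of them 0, equal and positive, distinct and positive.\<close>

lemma double_sum_split_diagonal:
  fixes g :: "nat \<Rightarrow> nat \<Rightarrow> real"
  shows "(\<Sum>(i, j)\<in>{0..N} \<times> {0..N}. g i j) =
    g 0 0 + (\<Sum>j=1..N. g 0 j + g j 0) + (\<Sum>j=1..N. g j j) + (\<Sum>i=1..N. \<Sum>j\<in>{1..N} - {i}. g i j)"
proof -
  have "(\<Sum>(i, j)\<in>{0..N} \<times> {0..N}. g i j) = (\<Sum>i=0..N. \<Sum>j=0..N. g i j)"
    by (rule sum.cartesian_product[symmetric])
  also have "\<dots> = g 0 0 + (\<Sum>j=1..N. g 0 j) + (\<Sum>i=1..N. g i 0 + (\<Sum>j=1..N. g i j))"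
    by (simp add: sum.atLeast_Suc_atMost)
  also have "(\<Sum>i=1..N. g i 0 + (\<Sum>j=1..N. g i j)) =
      (\<Sum>i=1..N. g i 0 + (g i i + (\<Sum>j\<in>{1..N} - {i}. g i j)))"
    by (intro sum.cong) (auto simp: sum.remove)
  finally show ?thesis
    by (simp add: sum.distrib)
qed

text \<open>The algebraic core, with \<open>a\<close> and \<open>b\<close> the weights of the two
  defaulted obligors, \<open>v\<close> those of a third one and \<open>q\<close> the reciprocal
  shapes. Without the term for \<open>i = j\<close> the double sum factorises and the sums of
  \<open>a\<close> and \<open>b\<close> become 1; the term for \<open>i = j\<close> collapses to a
  single sum with the factor \<open>1 + 2 * (v i * q i)\<close>.\<close>

lemma stress_factor_identity:
  fixes a b v q :: "nat \<Rightarrow> real"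
  assumes a: "(\<Sum>k=0..N. a k) = 1" and b: "(\<Sum>k=0..N. b k) = 1"
  shows "(\<Sum>(i, j)\<in>{0..N} \<times> {0..N}.
      a i * b j * (1 + (if i = j then q i else 0)) * (1 + v i * q i + v j * q j)) =
    1 + 2 * (\<Sum>k=0..N. v k * a k * b k * (q k)\<^sup>2) + (\<Sum>k=0..N. (v k * a k + v k * b k + a k * b k) * q k)"
proof -
  have "(\<Sum>(i, j)\<in>{0..N} \<times> {0..N}.
      a i * b j * (1 + (if i = j then q i else 0)) * (1 + v i * q i + v j * q j)) =
    (\<Sum>i=0..N. \<Sum>j=0..N. a i * b j + (a i * v i * q i) * b j + a i * (b j * v j * q j) +
      (if i = j then a i * b i * q i * (1 + 2 * (v i * q i)) else 0))"
    unfolding sum.cartesian_product[symmetric]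
    by (intro sum.cong refl) (simp add: algebra_simps)
  also have "\<dots> = 1 + (\<Sum>i=0..N. a i * v i * q i) + (\<Sum>j=0..N. b j * v j * q j) +
      (\<Sum>i=0..N. a i * b i * q i * (1 + 2 * (v i * q i)))"
    by (simp add: sum.distrib a b flip: sum_distrib_left sum_distrib_right)
  also have "\<dots> = 1 + 2 * (\<Sum>k=0..N. v k * a k * b k * (q k)\<^sup>2) +
      (\<Sum>k=0..N. (v k * a k + v k * b k + a k * b k) * q k)"
    by (simp add: sum.distrib sum_distrib_left algebra_simps power2_eq_square)
  finally show ?thesis .
qed

text \<open>The variance of \<open>S k\<close>: \<open>1 / \<alpha> k\<close> for a Gamma factor and
  0 for the constant factor, whatever the value of \<open>\<alpha> 0\<close>.\<close>

definition inv_shape :: "(nat \<Rightarrow> real) \<Rightarrow> nat \<Rightarrow> real" where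
  "inv_shape \<alpha> k = (if k = 0 then 0 else 1 / \<alpha> k)"

text \<open>The bracket is the mixed moment of \<open>S i\<close> and \<open>S j\<close>: by
  independence 1 off the diagonal, and 1 plus the variance on it.\<close>

definition two_defaults_weight ::
  "nat \<Rightarrow> (nat \<Rightarrow> real) \<Rightarrow> ('a \<Rightarrow> nat \<Rightarrow> real) \<Rightarrow> 'a \<Rightarrow> 'a \<Rightarrow> nat \<times> nat \<Rightarrow> real" where
  "two_defaults_weight N \<alpha> w A1 A2 = (\<lambda>(i, j).
    w A1 i * w A2 j * (1 + (if i = j then inv_shape \<alpha> i else 0)) / joint_factor N \<alpha> w A1 A2)"

definition shifted_shape :: "(nat \<Rightarrow> real) \<Rightarrow> nat \<times> nat \<Rightarrow> nat \<Rightarrow> real" where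
  "shifted_shape \<alpha> = (\<lambda>(i, j) k. \<alpha> k + unit_vec i k + unit_vec j k)"

text \<open>Since \<^term>\<open>unit_vec 0\<close> vanishes on \<open>{1..N}\<close>, the constant factor can be treated like the others.\<close>

lemma two_defaults_prob_eq:
  assumes \<alpha>: "\<And>k. k \<in> {1..N} \<Longrightarrow> 0 < \<alpha> k"
  shows "two_defaults_prob Obl N \<alpha> w p F A1 A2 x =
    (\<Sum>ij\<in>{0..N} \<times> {0..N}. two_defaults_weight N \<alpha> w A1 A2 ij *
      pmf (cr_law Obl N \<alpha> w p F (shifted_shape \<alpha> ij)) x)"
proof -
  define P where "P \<beta> = pmf (cr_law Obl N \<alpha> w p F \<beta>) x" for \<beta>
  define J where "J = joint_factor N \<alpha> w A1 A2"
  define g where "g i j = w A1 i * w A2 j * (1 + (if i = j then inv_shape \<alpha> i else 0)) *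
    P (shifted_shape \<alpha> (i, j))" for i j
  \<comment> \<open>The exponent functions on the two sides may differ at index 0; only the laws
    agree.\<close>
  have shift: "P (shifted_shape \<alpha> (0, 0)) = P \<alpha>"
    "P (shifted_shape \<alpha> (0, j)) = P (\<lambda>k. \<alpha> k + unit_vec j k)"
    "P (shifted_shape \<alpha> (j, 0)) = P (\<lambda>k. \<alpha> k + unit_vec j k)"
    "P (shifted_shape \<alpha> (j, j)) = P (\<lambda>k. \<alpha> k + 2 * unit_vec j k)"
    "P (shifted_shape \<alpha> (i, j)) = P (\<lambda>k. \<alpha> k + unit_vec i k + unit_vec j k)" for i j
    unfolding P_def
    by (intro arg_cong[where f = "\<lambda>L. pmf L x"] cr_law_cong; simp add: shifted_shape_def unit_vec_def)+
  have "two_defaults_prob Obl N \<alpha> w p F A1 A2 x = 1 / J *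
      (g 0 0 + (\<Sum>j=1..N. g 0 j + g j 0) + (\<Sum>j=1..N. g j j) +
        (\<Sum>i=1..N. \<Sum>j\<in>{1..N} - {i}. g i j))"
    unfolding two_defaults_prob_def Let_def J_def[symmetric] P_def[symmetric]
  proof (intro arg_cong2[where f = "(*)"] arg_cong2[where f = "(+)"] sum.cong refl)
    show "w A1 0 * w A2 0 * P \<alpha> = g 0 0"
      unfolding g_def shift(1) by (simp add: inv_shape_def)
    show "(w A1 0 * w A2 j + w A1 j * w A2 0) * P (\<lambda>k. \<alpha> k + unit_vec j k) = g 0 j + g j 0"
      if "j \<in> {1..N}" for j
      using that unfolding g_def shift(2,3) by (simp add: inv_shape_def distrib_right)
    \<comment> \<open>\<open>(\<alpha> j + 1) / \<alpha> j\<close> is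
      \<open>1 + inv_shape \<alpha> j\<close>, the diagonal bracket in the weight.\<close>
    show "w A1 j * w A2 j * ((\<alpha> j + 1) / \<alpha> j) * P (\<lambda>k. \<alpha> k + 2 * unit_vec j k) = g j j"
      if "j \<in> {1..N}" for j
      using that \<alpha>[OF that] unfolding g_def shift(4) by (simp add: inv_shape_def add_divide_distrib)
    show "w A1 i * w A2 j * P (\<lambda>k. \<alpha> k + unit_vec i k + unit_vec j k) = g i j"
      if "j \<in> {1..N} - {i}" for i j
      using that unfolding g_def shift(5) by simp
  qed
  also have "\<dots> = 1 / J * (\<Sum>(i, j)\<in>{0..N} \<times> {0..N}. g i j)"
    by (simp only: double_sum_split_diagonal)
  also have "\<dots> = (\<Sum>ij\<in>{0..N} \<times> {0..N}. two_defaults_weight N \<alpha> w A1 A2 ij * P (shifted_shape \<alpha> ij))"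
    unfolding sum_distrib_left
    by (intro sum.cong) (auto simp: g_def J_def two_defaults_weight_def)
  finally show ?thesis
    by (simp only: P_def)
qed

section \<open>Averaging the means over the pairs of factors\<close>

lemma sum_drop_inv_shape:
  "(\<Sum>k=0..N. f k * inv_shape \<alpha> k) = (\<Sum>k=1..N. f k / \<alpha> k)"
  by (simp add: sum.atLeast_Suc_atMost inv_shape_def)

text \<open>Once \<open>p A / joint_factor N \<alpha> w A1 A2\<close> is pulled out,
  \<open>stress_factor_identity\<close> applies. \<open>A1\<close> and \<open>A2\<close> are
  excluded because \<open>stressed_pd\<close> leaves their probabilities unchanged.\<close>

lemma two_defaults_mean_factor:
  assumes "(\<Sum>k=0..N. w A1 k) = 1" and "(\<Sum>k=0..N. w A2 k) = 1"
    and "A \<noteq> A1" and "A \<noteq> A2"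
  shows "(\<Sum>(i, j)\<in>{0..N} \<times> {0..N}. two_defaults_weight N \<alpha> w A1 A2 (i, j) *
      (p A * (1 + w A i * inv_shape \<alpha> i + w A j * inv_shape \<alpha> j))) = stressed_pd N \<alpha> w p A1 A2 A"
proof -
  let ?J = "joint_factor N \<alpha> w A1 A2" and ?q = "inv_shape \<alpha>"
  have "(\<Sum>(i, j)\<in>{0..N} \<times> {0..N}. two_defaults_weight N \<alpha> w A1 A2 (i, j) *
      (p A * (1 + w A i * ?q i + w A j * ?q j))) =
    p A / ?J * (\<Sum>(i, j)\<in>{0..N} \<times> {0..N}.
      w A1 i * w A2 j * (1 + (if i = j then ?q i else 0)) * (1 + w A i * ?q i + w A j * ?q j))"
    unfolding sum_distrib_left by (intro sum.cong) (auto simp: two_defaults_weight_def)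
  \<comment> \<open>Writing the square as a product lets \<open>sum_drop_inv_shape\<close> consume
    one factor \<open>?q k\<close> and drop index 0; the other becomes \<open>1 / \<alpha> k\<close>
    afterwards.\<close>
  also have "\<dots> = p A / ?J * (1 + 2 * (\<Sum>k=0..N. w A k * w A1 k * w A2 k * ?q k * ?q k) +
      (\<Sum>k=0..N. (w A k * w A1 k + w A k * w A2 k + w A1 k * w A2 k) * ?q k))"
    unfolding stress_factor_identity[OF assms(1,2), where v = "w A" and q = ?q]
    by (simp only: power2_eq_square mult.assoc)
  also have "\<dots> = p A / ?J * (1 + 2 * (\<Sum>k=1..N. w A k * w A1 k * w A2 k * ?q k / \<alpha> k) +
      (\<Sum>k=1..N. (w A k * w A1 k + w A k * w A2 k + w A1 k * w A2 k) / \<alpha> k))"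
    by (simp only: sum_drop_inv_shape)
  also have "(\<Sum>k=1..N. w A k * w A1 k * w A2 k * ?q k / \<alpha> k) =
      (\<Sum>k=1..N. w A k * w A1 k * w A2 k / (\<alpha> k)\<^sup>2)"
    by (intro sum.cong) (auto simp: inv_shape_def power2_eq_square)
  finally show ?thesis
    using assms(3,4) by (simp add: stressed_pd_def)
qed

text \<open>Raising the exponent of factor \<open>l\<close> by 1 adds
  \<open>w A l / \<alpha> l\<close> to the weighted sum of exponent ratios, or nothing if
  \<open>l = 0\<close>; the unshifted part is the sum of the weights, which is 1.\<close>

lemma (in credit_risk_plus) mean_loss_cr_law_shifted:
  assumes i: "i \<in> {0..N}" and j: "j \<in> {0..N}"
  shows "mean_loss (measure_pmf (cr_law Obl N \<alpha> w p F (shifted_shape \<alpha> (i, j)))) =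
    (\<Sum>A\<in>Obl. ennreal (p A * (1 + w A i * inv_shape \<alpha> i + w A j * inv_shape \<alpha> j)) *
      mean_loss (measure_pmf (F A)))"
proof -
  have "0 < shifted_shape \<alpha> (i, j) k" if "k \<in> {1..N}" for k
    using \<alpha>_pos[OF that] by (auto simp: shifted_shape_def unit_vec_def)
  then have "mean_loss (measure_pmf (cr_law Obl N \<alpha> w p F (shifted_shape \<alpha> (i, j)))) =
    (\<Sum>A\<in>Obl. ennreal (p A * (w A 0 + (\<Sum>k=1..N. w A k * (shifted_shape \<alpha> (i, j) k / \<alpha> k)))) *
      mean_loss (measure_pmf (F A)))"
    using p_pos w_range by (intro cr_law_gf_mean finite_Obl \<alpha>_pos) (auto simp: less_imp_le)
  also have "\<dots> = (\<Sum>A\<in>Obl. ennreal (p A * (1 + w A i * inv_shape \<alpha> i + w A j * inv_shape \<alpha> j)) *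
      mean_loss (measure_pmf (F A)))"
  proof (rule sum.cong)
    fix A assume A: "A \<in> Obl"
    have unit: "(\<Sum>k=1..N. w A k * unit_vec l k / \<alpha> k) = w A l * inv_shape \<alpha> l" if "l \<in> {0..N}" for l
    proof -
      have "(\<Sum>k=1..N. w A k * unit_vec l k / \<alpha> k) = (\<Sum>k=0..N. w A k * unit_vec l k * inv_shape \<alpha> k)"
        by (rule sum_drop_inv_shape[symmetric])
      also have "\<dots> = (\<Sum>k=0..N. if k = l then w A l * inv_shape \<alpha> l else 0)"
        by (intro sum.cong) (auto simp: unit_vec_def)
      finally show ?thesis
        using that by simp
    qed
    have "(\<Sum>k=1..N. w A k * (shifted_shape \<alpha> (i, j) k / \<alpha> k)) =
        (\<Sum>k=1..N. w A k + w A k * unit_vec i k / \<alpha> k + w A k * unit_vec j k / \<alpha> k)"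
    proof (rule sum.cong)
      fix k assume "k \<in> {1..N}"
      from \<alpha>_pos[OF this] show "w A k * (shifted_shape \<alpha> (i, j) k / \<alpha> k) =
          w A k + w A k * unit_vec i k / \<alpha> k + w A k * unit_vec j k / \<alpha> k"
        by (simp add: shifted_shape_def field_simps)
    qed simp
    also have "\<dots> = (\<Sum>k=1..N. w A k) + w A i * inv_shape \<alpha> i + w A j * inv_shape \<alpha> j"
      by (simp only: sum.distrib unit[OF i] unit[OF j])
    also have "w A 0 + \<dots> = 1 + w A i * inv_shape \<alpha> i + w A j * inv_shape \<alpha> j"
      using w_sum[OF A] by (simp add: sum.atLeast_Suc_atMost)
    finally show "ennreal (p A * (w A 0 + (\<Sum>k=1..N. w A k * (shifted_shape \<alpha> (i, j) k / \<alpha> k)))) *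
        mean_loss (measure_pmf (F A)) =
      ennreal (p A * (1 + w A i * inv_shape \<alpha> i + w A j * inv_shape \<alpha> j)) * mean_loss (measure_pmf (F A))"
      by (simp only:)
  qed simp
  finally show ?thesis .
qed

text \<open>The mean of the mixture is taken law by law, and the sums over pairs and over obligors
  are exchanged, so that \<open>two_defaults_mean_factor\<close> applies to each obligor
  separately.\<close>

lemma (in credit_risk_plus) mean_loss_two_defaults:
  assumes A1: "A1 \<in> Obl" and A2: "A2 \<in> Obl"
    and no_exposure: "F A1 = return_pmf 0" "F A2 = return_pmf 0"
  shows "mean_loss (two_defaults_law Obl N \<alpha> w p F A1 A2) =
    (\<Sum>A\<in>Obl. ennreal (stressed_pd N \<alpha> w p A1 A2 A) * mean_loss (measure_pmf (F A)))"
proof -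
  let ?I = "{0..N} \<times> {0..N}" and ?d = "two_defaults_weight N \<alpha> w A1 A2"
  let ?e = "\<lambda>A. mean_loss (measure_pmf (F A))"
  define f where "f A = (\<lambda>(i, j). p A * (1 + w A i * inv_shape \<alpha> i + w A j * inv_shape \<alpha> j))" for A
  have q: "0 \<le> inv_shape \<alpha> k" if "k \<in> {0..N}" for k
    using \<alpha>_pos[of k] that by (auto simp: inv_shape_def less_imp_le)
  have "0 \<le> joint_factor N \<alpha> w A1 A2"
    unfolding joint_factor_def using w_range[OF A1] w_range[OF A2] \<alpha>_pos
    by (intro add_nonneg_nonneg sum_nonneg divide_nonneg_nonneg mult_nonneg_nonneg)
      (auto simp: less_imp_le)
  then have d: "0 \<le> ?d ij" if "ij \<in> ?I" for ij
    using that w_range[OF A1] w_range[OF A2] q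
    by (auto simp: two_defaults_weight_def intro!: divide_nonneg_nonneg mult_nonneg_nonneg add_nonneg_nonneg)
  have f: "0 \<le> f A ij" if "A \<in> Obl" "ij \<in> ?I" for A ij
    using that w_range[OF that(1)] q p_pos[OF that(1)]
    by (auto simp: f_def less_imp_le intro!: mult_nonneg_nonneg add_nonneg_nonneg)
  have prob: "two_defaults_prob Obl N \<alpha> w p F A1 A2 x =
      (\<Sum>ij\<in>?I. ?d ij * pmf (cr_law Obl N \<alpha> w p F (shifted_shape \<alpha> ij)) x)" for x
    by (rule two_defaults_prob_eq) (rule \<alpha>_pos)
  have "mean_loss (two_defaults_law Obl N \<alpha> w p F A1 A2) =
      (\<Sum>ij\<in>?I. ennreal (?d ij) * mean_loss (measure_pmf (cr_law Obl N \<alpha> w p F (shifted_shape \<alpha> ij))))"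
    unfolding two_defaults_law_def prob
    using d by (intro mean_loss_mixture) auto
  also have "\<dots> = (\<Sum>ij\<in>?I. ennreal (?d ij) * (\<Sum>A\<in>Obl. ennreal (f A ij) * ?e A))"
    by (intro sum.cong) (auto simp: mean_loss_cr_law_shifted f_def)
  also have "\<dots> = (\<Sum>A\<in>Obl. \<Sum>ij\<in>?I. ennreal (?d ij) * (ennreal (f A ij) * ?e A))"
    unfolding sum_distrib_left by (rule sum.swap)
  also have "\<dots> = (\<Sum>A\<in>Obl. ennreal (stressed_pd N \<alpha> w p A1 A2 A) * ?e A)"
  proof (rule sum.cong)
    fix A assume A: "A \<in> Obl"
    show "(\<Sum>ij\<in>?I. ennreal (?d ij) * (ennreal (f A ij) * ?e A)) =
        ennreal (stressed_pd N \<alpha> w p A1 A2 A) * ?e A"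
    proof (cases "A = A1 \<or> A = A2")
      case True
      \<comment> \<open>A zero mean exposure kills the summands of \<open>A1\<close> and
        \<open>A2\<close> on both sides, whatever stands in front.\<close>
      then have "?e A = 0"
        using no_exposure by (auto simp: mean_loss_def)
      then show ?thesis
        by simp
    next
      case False
      \<comment> \<open>Nonnegativity of the real coefficients permits summing them before
        multiplying by \<open>?e A\<close>, which may be infinite.\<close>
      have "(\<Sum>ij\<in>?I. ennreal (?d ij) * (ennreal (f A ij) * ?e A)) =
          (\<Sum>ij\<in>?I. ennreal (?d ij * f A ij)) * ?e A"
        unfolding sum_distrib_right using d f[OF A]
        by (intro sum.cong) (simp_all add: ennreal_mult mult.assoc)
      also have "(\<Sum>ij\<in>?I. ennreal (?d ij * f A ij)) = ennreal (\<Sum>ij\<in>?I. ?d ij * f A ij)"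
        using d f[OF A] by (intro sum_ennreal mult_nonneg_nonneg)
      also have "(\<Sum>ij\<in>?I. ?d ij * f A ij) = stressed_pd N \<alpha> w p A1 A2 A"
        using two_defaults_mean_factor[OF w_sum[OF A1] w_sum[OF A2], of A \<alpha> p] False
        by (simp add: f_def case_prod_unfold)
      finally show ?thesis .
    qed
  qed simp
  finally show ?thesis .
qed

theorem proposition4p3:
  fixes M :: "'m measure" and M' :: "'n measure"
    and Obl :: "'a set" and N :: nat
    and \<alpha> :: "nat \<Rightarrow> real" and w :: "'a \<Rightarrow> nat \<Rightarrow> real" and p :: "'a \<Rightarrow> real"
    and F :: "'a \<Rightarrow> nat pmf"
    and S :: "nat \<Rightarrow> 'm \<Rightarrow> real" and D :: "'a \<Rightarrow> 'm \<Rightarrow> nat" and E :: "'a \<Rightarrow> nat \<Rightarrow> 'm \<Rightarrow> nat"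
    and S' :: "nat \<Rightarrow> 'n \<Rightarrow> real" and D' :: "'a \<Rightarrow> 'n \<Rightarrow> nat" and E' :: "'a \<Rightarrow> nat \<Rightarrow> 'n \<Rightarrow> nat"
    and A1 A2 :: 'a
  assumes model: "credit_risk_plus M Obl N \<alpha> w p F S D E"
    and A1: "A1 \<in> Obl" and A2: "A2 \<in> Obl" and A1_neq_A2: "A1 \<noteq> A2"
    and no_exposure: "F A1 = return_pmf 0" "F A2 = return_pmf 0"
    and stressed_model:
      "credit_risk_plus M' Obl N \<alpha> w (stressed_pd N \<alpha> w p A1 A2) F S' D' E'"
  shows "mean_loss (two_defaults_law Obl N \<alpha> w p F A1 A2) = mean_loss (loss_law M' Obl D' E')"
  by (simp only: credit_risk_plus.mean_loss_two_defaults[OF model A1 A2 no_exposure]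
      credit_risk_plus.mean_loss_law[OF stressed_model])

end
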